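(* Let $\alpha$ be a fixed 2-tensor (bivector field) on $\mathbb{R}^d$, let $W$ be a system of weights, and consider the product $$f\star g=\sum_{n\ge 0}\epsilon^n\sum_{\Gamma\in G^0_{n,2}}W_\Gamma\, U_\Gamma(\alpha^n)(f,g),\qquad f,g\in A=C^\infty(\mathbb{R}^d).$$ Then $\star$ is associative, i.e. $\star\circ\star=0$ for the Gerstenhaber composition, if and only if $$W(\Delta_b(\Gamma))=0\qquad\text{for all }\Gamma\in G_{n,3}^{-1}\ (n\ge0).$$
   Context: Graphs. $G_{n,m}^l$ denotes the set of finite directed graphs with $n$ (unlabeled) internal vertices, $m$ linearly ordered boundary vertices having no outgoing edges, and $2n+m-2+l$ edges, without circuits (directed cycles). In $G^0_{n,2}$ and $G^{-1}_{n,3}$ there are $2n$ edges and each internal vertex has exactly two outgoing edges. Graphs are taken as orientation classes: the two outgoing edges of each internal vertex are ordered, and exchanging their order at one vertex multiplies the graph by $-1$ (so graphs with parallel edges vanish). Sums over $G$ use one representative of each nonzero class; $W$ is a linear functional on the span $H$ of graphs, with $W_\Gamma=W(\Gamma)$. $b_0$ is the graph with two boundary vertices and no internal vertices. Operators. The same fixed tensor $\alpha=\sum\alpha^{ij}\partial_i\otimes\partial_j$, $\alpha^{ij}=-\alpha^{ji}$ (not necessarily Poisson), is attached to all internal vertices. For $\Gamma$ with $n$ internal vertices, boundary vertices $1,\dots,m$ and edge set $E$, $$U_\Gamma(\alpha^n)(f_1,\dots,f_m)=\sum_{I:E\to\{1,\dots,d\}}\ \prod_{v}\Big(\prod_{e\to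 v}\partial_{I(e)}\Big)\alpha^{I(e_v^1)I(e_v^2)}\ \prod_{j=1}^m\Big(\prod_{e\to j}\partial_{I(e)}\Big)f_j,$$ where $v$ runs over internal vertices with ordered outgoing edges $e_v^1,e_v^2$, and $e\to x$ means that $e$ ends at $x$. For bilinear operations, the Gerstenhaber composition is $(P\circ Q)(f,g,h)=P(Q(f,g),h)-P(f,Q(g,h))$. Composition of graphs. $\Gamma_1\circ_i\Gamma_2$ is obtained by replacing the $i$-th boundary vertex of $\Gamma_1$ by $\Gamma_2$ and summing over all ways of reattaching the edges of $\Gamma_1$ that ended at that vertex to (internal or boundary) vertices of $\Gamma_2$. For graphs with two boundary vertices, $\Gamma_1\circ\Gamma_2=\Gamma_1\circ_1\Gamma_2-\Gamma_1\circ_2\Gamma_2$. Coproduct. For $\Gamma\in G^{-1}_{n,3}$, the reduced coproduct is $\Delta_b\Gamma=\sum(-1)^{|j|}(\Gamma/\gamma)\otimes\gamma$, the sum over subgraphs $\gamma\in G^0_{l,2}$ of $\Gamma$ whose boundary consists of two consecutive boundary vertices of $\Gamma$ (including $\gamma=b_0$) and whose collapse to a single boundary vertex gives a graph $\Gamma/\gamma\in G^0_{n-l,2}$; $|j|$ is the number of boundary vertices of $\Gamma$ to the left of $\gamma$. Terms are counted so that $\Delta_b$ is dual to $\circ$: the coefficient of $\Gamma_1\otimes\Gamma_2$ in $\Delta_b\Gamma$ equals the coefficient of $\Gamma$ in $\Gamma_1\circ\Gamma_2$. $W$ is extended multiplicatively to tensors: $W(\Gamma_1\otimes\Gamma_2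)=W(\Gamma_1)W(\Gamma_2)$.
   Formalization: For one fixed α the "only if" fails (e.g. α=0, with weight 1 on b_0 and on the wedge, 0 otherwise), so associativity of ⋆ is required for every dimension d and every smooth bivector field α on R^d; the "if" part still covers each single α. *)

theory Defs
  imports
    "HOL-Analysis.Analysis"
    "HOL-Computational_Algebra.Formal_Power_Series"
    "HOL-Library.Function_Algebras"
    "HOL-Library.Poly_Mapping"
begin

section \<open>Smooth functions on Euclidean space of variable dimension\<close>

text \<open>
  The dimension \<open>d\<close> is quantified inside the statement, so Euclidean \<open>d\<close>-space is
  \<^term>\<open>topspace (Euclidean_space d)\<close>, with coordinates numbered \<open>0, \<dots>, d - 1\<close>. A function on it
  is a function on \<^typ>\<open>nat \<Rightarrow> real\<close> whose values outside this set are irrelevant.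
\<close>

definition pd :: "nat \<Rightarrow> ((nat \<Rightarrow> real) \<Rightarrow> real) \<Rightarrow> (nat \<Rightarrow> real) \<Rightarrow> real" where
  "pd i f x = deriv (\<lambda>t. f (x(i := t))) (x i)"

definition pds :: "nat list \<Rightarrow> ((nat \<Rightarrow> real) \<Rightarrow> real) \<Rightarrow> (nat \<Rightarrow> real) \<Rightarrow> real" where
  "pds is f = foldr pd is f"

definition smooth_functions :: "nat \<Rightarrow> ((nat \<Rightarrow> real) \<Rightarrow> real) set" where
  "smooth_functions d = {f. \<forall>is. set is \<subseteq> {..<d} \<longrightarrow>
     continuous_map (Euclidean_space d) euclideanreal (pds is f) \<and>
     (\<forall>i<d. \<forall>x\<in>topspace (Euclidean_space d).
        (\<lambda>t. pds is f (x(i := t))) differentiable (at (x i)))}"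

definition bivector_field :: "nat \<Rightarrow> (nat \<Rightarrow> nat \<Rightarrow> (nat \<Rightarrow> real) \<Rightarrow> real) \<Rightarrow> bool" where
  "bivector_field d \<alpha> \<longleftrightarrow> (\<forall>i<d. \<forall>j<d. \<alpha> i j \<in> smooth_functions d \<and>
     (\<forall>x\<in>topspace (Euclidean_space d). \<alpha> i j x = - \<alpha> j i x))"


section \<open>Graphs\<close>

datatype vertex = Internal nat | Boundary nat

text \<open>
  A labelled graph with \<open>n\<close> internal vertices, each with two ordered outgoing edges, is the list of
  the pairs of their targets. An edge \<open>(v, c)\<close> is the first (\<open>c = False\<close>) or the second
  (\<open>c = True\<close>) outgoing edge of the internal vertex \<open>v\<close>. Boundary vertices are numbered from 0.
\<close>

type_synonym graph = "(vertex \<times> vertex) list"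

definition edges :: "graph \<Rightarrow> (nat \<times> bool) list" where
  "edges \<Gamma> = List.product [0..<length \<Gamma>] [False, True]"

definition target :: "graph \<Rightarrow> nat \<times> bool \<Rightarrow> vertex" where
  "target \<Gamma> e = (if snd e then snd (\<Gamma> ! fst e) else fst (\<Gamma> ! fst e))"

definition in_edges :: "graph \<Rightarrow> vertex \<Rightarrow> (nat \<times> bool) list" where
  "in_edges \<Gamma> x = filter (\<lambda>e. target \<Gamma> e = x) (edges \<Gamma>)"

definition vertices :: "nat \<Rightarrow> nat \<Rightarrow> vertex set" where
  "vertices n m = Internal ` {..<n} \<union> Boundary ` {..<m}"

text \<open>
  \<open>graphs n m\<close>: all labelled graphs with \<open>n\<close> internal and \<open>m\<close> boundary vertices and without
  circuits. They have \<open>2 * n\<close> edges, so \<open>m = 2\<close> gives the degree \<open>0\<close> graphs and \<open>m = 3\<close> those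
  of degree \<open>-1\<close>.
\<close>

definition graphs :: "nat \<Rightarrow> nat \<Rightarrow> graph set" where
  "graphs n m = {\<Gamma>. length \<Gamma> = n \<and> target \<Gamma> ` set (edges \<Gamma>) \<subseteq> vertices n m \<and>
     acyclic {(u, v). \<exists>c. (u, c) \<in> set (edges \<Gamma>) \<and> target \<Gamma> (u, c) = Internal v}}"

text \<open>
  \<open>iso s \<Gamma> \<Gamma>'\<close>: \<open>\<Gamma>'\<close> arises from \<open>\<Gamma>\<close> by renumbering the internal vertices by \<open>\<sigma>\<close> and exchanging
  the two outgoing edges of the vertices in \<open>T\<close>, so that \<open>\<Gamma>' = s \<Gamma>\<close> in the space of graphs.
\<close>

definition iso :: "real \<Rightarrow> graph \<Rightarrow> graph \<Rightarrow> bool" where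
  "iso s \<Gamma> \<Gamma>' \<longleftrightarrow> length \<Gamma>' = length \<Gamma> \<and>
     (\<exists>\<sigma> T. \<sigma> permutes {..<length \<Gamma>} \<and> T \<subseteq> {..<length \<Gamma>} \<and> s = (-1) ^ card T \<and>
        (\<forall>v<length \<Gamma>. \<forall>c. target \<Gamma>' (\<sigma> v, c \<noteq> (v \<in> T)) =
           case_vertex (\<lambda>u. Internal (\<sigma> u)) Boundary (target \<Gamma> (v, c))))"

definition vanishing :: "graph \<Rightarrow> bool" where
  "vanishing \<Gamma> \<longleftrightarrow> iso (-1) \<Gamma> \<Gamma>"

definition rep :: "graph \<Rightarrow> graph" where
  "rep \<Gamma> = (SOME \<Gamma>'. \<exists>s. iso s \<Gamma> \<Gamma>')"

definition reps :: "nat \<Rightarrow> nat \<Rightarrow> graph set" where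
  "reps n m = rep ` {\<Gamma> \<in> graphs n m. \<not> vanishing \<Gamma>}"

text \<open>
  The space of graphs is the free vector space on labelled graphs modulo \<open>\<Gamma>' = s \<Gamma>\<close> whenever
  \<open>iso s \<Gamma> \<Gamma>'\<close>. A linear functional on it is determined by its values on labelled graphs, and
  these are subject to the following condition.
\<close>

definition weight_system :: "(graph \<Rightarrow> real) \<Rightarrow> bool" where
  "weight_system W \<longleftrightarrow> (\<forall>n. \<forall>\<Gamma>\<in>graphs n 2. \<forall>\<Gamma>' s. iso s \<Gamma> \<Gamma>' \<longrightarrow> W \<Gamma>' = s * W \<Gamma>)"

text \<open>The coefficient of (the class of) \<open>\<Gamma>\<close> in a linear combination of labelled graphs:\<close>

definition graph_coeff :: "graph \<Rightarrow> (graph \<Rightarrow>\<^sub>0 real) \<Rightarrow> real" where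
  "graph_coeff \<Gamma> p = (\<Sum>\<Gamma>'\<in>Poly_Mapping.keys p. Poly_Mapping.lookup p \<Gamma>' *
     (if vanishing \<Gamma> then 0 else if iso 1 \<Gamma> \<Gamma>' then 1 else if iso (-1) \<Gamma> \<Gamma>' then -1 else 0))"


section \<open>Operators and the star product\<close>

text \<open>
  For smooth functions the order in which the partial derivatives are taken is irrelevant; it is
  fixed here by the order of \<^const>\<open>in_edges\<close>.
\<close>

definition U :: "nat \<Rightarrow> (nat \<Rightarrow> nat \<Rightarrow> (nat \<Rightarrow> real) \<Rightarrow> real) \<Rightarrow> graph \<Rightarrow>
    ((nat \<Rightarrow> real) \<Rightarrow> real) list \<Rightarrow> (nat \<Rightarrow> real) \<Rightarrow> real" where
  "U d \<alpha> \<Gamma> fs x = (\<Sum>I \<in> set (edges \<Gamma>) \<rightarrow>\<^sub>E {..<d}.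
     (\<Prod>v<length \<Gamma>. pds (map I (in_edges \<Gamma> (Internal v))) (\<alpha> (I (v, False)) (I (v, True))) x) *
     (\<Prod>j<length fs. pds (map I (in_edges \<Gamma> (Boundary j))) (fs ! j) x))"

definition star_coeff :: "(graph \<Rightarrow> real) \<Rightarrow> nat \<Rightarrow> (nat \<Rightarrow> nat \<Rightarrow> (nat \<Rightarrow> real) \<Rightarrow> real) \<Rightarrow> nat \<Rightarrow>
    ((nat \<Rightarrow> real) \<Rightarrow> real) \<Rightarrow> ((nat \<Rightarrow> real) \<Rightarrow> real) \<Rightarrow> (nat \<Rightarrow> real) \<Rightarrow> real" where
  "star_coeff W d \<alpha> n f g x = (\<Sum>\<Gamma>\<in>reps n 2. W \<Gamma> * U d \<alpha> \<Gamma> [f, g] x)"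

text \<open>
  The product takes values in formal power series in \<open>\<epsilon>\<close>, so it is extended \<open>\<epsilon>\<close>-bilinearly to
  such series in order to be composed with itself.
\<close>

definition star :: "(graph \<Rightarrow> real) \<Rightarrow> nat \<Rightarrow> (nat \<Rightarrow> nat \<Rightarrow> (nat \<Rightarrow> real) \<Rightarrow> real) \<Rightarrow>
    ((nat \<Rightarrow> real) \<Rightarrow> real) fps \<Rightarrow> ((nat \<Rightarrow> real) \<Rightarrow> real) fps \<Rightarrow> ((nat \<Rightarrow> real) \<Rightarrow> real) fps" where
  "star W d \<alpha> F G = Abs_fps (\<lambda>N x. \<Sum>(n, a, b) \<in> {(n, a, b). n + a + b = N}.
     star_coeff W d \<alpha> n (fps_nth F a) (fps_nth G b) x)"

definition gerstenhaber :: "('a::minus \<Rightarrow> 'a \<Rightarrow> 'a) \<Rightarrow> ('a \<Rightarrow> 'a \<Rightarrow> 'a) \<Rightarrow> 'a \<Rightarrow> 'a \<Rightarrow> 'a \<Rightarrow> 'a" where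
  "gerstenhaber P Q f g h = P (Q f g) h - P f (Q g h)"

definition star_associative :: "(graph \<Rightarrow> real) \<Rightarrow> nat \<Rightarrow> (nat \<Rightarrow> nat \<Rightarrow> (nat \<Rightarrow> real) \<Rightarrow> real) \<Rightarrow> bool" where
  "star_associative W d \<alpha> \<longleftrightarrow>
     (\<forall>f\<in>smooth_functions d. \<forall>g\<in>smooth_functions d. \<forall>h\<in>smooth_functions d.
      \<forall>N. \<forall>x\<in>topspace (Euclidean_space d).
        fps_nth (gerstenhaber (star W d \<alpha>) (star W d \<alpha>)
          (fps_const f) (fps_const g) (fps_const h)) N x = 0)"


section \<open>Composition and coproduct of graphs\<close>

text \<open>
  \<open>graft j \<Gamma>1 \<Gamma>2 \<rho>\<close> replaces the boundary vertex \<open>j\<close> of \<open>\<Gamma>1\<close> by \<open>\<Gamma>2\<close> (with two boundary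
  vertices), where \<open>\<rho>\<close> assigns to each edge of \<open>\<Gamma>1\<close> ending at \<open>j\<close> its new target in \<open>\<Gamma>2\<close>. The
  internal vertices of \<open>\<Gamma>1\<close> come first, followed by those of \<open>\<Gamma>2\<close>.
\<close>

definition graft :: "nat \<Rightarrow> graph \<Rightarrow> graph \<Rightarrow> (nat \<times> bool \<Rightarrow> vertex) \<Rightarrow> graph" where
  "graft j \<Gamma>1 \<Gamma>2 \<rho> =
     (let emb = case_vertex (\<lambda>u. Internal (length \<Gamma>1 + u)) (\<lambda>k. Boundary (j + k));
          att = (\<lambda>e. case target \<Gamma>1 e of
             Internal u \<Rightarrow> Internal u
           | Boundary k \<Rightarrow> if k = j then emb (\<rho> e) else Boundary (if k < j then k else k + 1))
      in map (\<lambda>v. (att (v, False), att (v, True))) [0..<length \<Gamma>1] @ map (map_prod emb emb) \<Gamma>2)"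

definition insertion :: "nat \<Rightarrow> graph \<Rightarrow> graph \<Rightarrow> (graph \<Rightarrow>\<^sub>0 real)" where
  "insertion j \<Gamma>1 \<Gamma>2 =
     (\<Sum>\<rho> \<in> set (in_edges \<Gamma>1 (Boundary j)) \<rightarrow>\<^sub>E vertices (length \<Gamma>2) 2.
        Poly_Mapping.single (graft j \<Gamma>1 \<Gamma>2 \<rho>) 1)"

definition rank :: "nat set \<Rightarrow> nat \<Rightarrow> nat" where
  "rank S u = card {w \<in> S. w < u}"

text \<open>
  The subgraph on the internal vertices \<open>S\<close> and the boundary vertices \<open>j, j + 1\<close>, and its collapse to
  a boundary vertex \<open>j\<close>. In both, the internal vertices are renumbered keeping their order.
\<close>

definition subgraph :: "graph \<Rightarrow> nat \<Rightarrow> nat set \<Rightarrow> graph" where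
  "subgraph \<Gamma> j S =
     (let r = case_vertex (\<lambda>u. Internal (rank S u)) (\<lambda>k. Boundary (k - j))
      in map (\<lambda>v. map_prod r r (\<Gamma> ! v)) (sorted_list_of_set S))"

definition collapse :: "graph \<Rightarrow> nat \<Rightarrow> nat set \<Rightarrow> graph" where
  "collapse \<Gamma> j S =
     (let R = {..<length \<Gamma>} - S;
          r = case_vertex (\<lambda>u. if u \<in> S then Boundary j else Internal (rank R u))
                (\<lambda>k. Boundary (if k \<le> j then k else k - 1))
      in map (\<lambda>v. map_prod r r (\<Gamma> ! v)) (sorted_list_of_set R))"

text \<open>
  Every internal vertex of the subgraph has both its outgoing edges in the subgraph, which is
  therefore determined by \<open>S\<close>. The case \<open>S = {}\<close> is the graph without internal vertices.
\<close>

definition subgraphs :: "graph \<Rightarrow> nat \<Rightarrow> nat set set" where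
  "subgraphs \<Gamma> j = {S. S \<subseteq> {..<length \<Gamma>} \<and>
     (\<forall>v\<in>S. \<forall>c. target \<Gamma> (v, c) \<in> Internal ` S \<union> {Boundary j, Boundary (j + 1)}) \<and>
     subgraph \<Gamma> j S \<in> graphs (card S) 2 \<and>
     collapse \<Gamma> j S \<in> graphs (length \<Gamma> - card S) 2}"

text \<open>
  The reduced coproduct of a graph with three boundary vertices. Each pair of classes
  \<open>(\<Gamma>1, \<Gamma>2)\<close> of a collapse \<open>\<Gamma> / \<gamma>\<close> and its subgraph \<open>\<gamma>\<close> on \<open>j, j + 1\<close> is counted with the
  coefficient of \<open>\<Gamma>\<close> in the insertion of \<open>\<Gamma>2\<close> at the boundary vertex \<open>j\<close> of \<open>\<Gamma>1\<close>. Because of the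
  signs, \<open>\<Gamma>1 \<otimes> \<Gamma>2\<close> has altogether the coefficient of \<open>\<Gamma>\<close> in
  \<open>insertion 0 \<Gamma>1 \<Gamma>2 - insertion 1 \<Gamma>1 \<Gamma>2\<close>, the composition of \<open>\<Gamma>1\<close> and \<open>\<Gamma>2\<close>. (The plain number of
  subgraphs differs from this coefficient by the factor
  \<open>card (Aut \<Gamma>) / (card (Aut \<Gamma>1) * card (Aut \<Gamma>2))\<close>.)
\<close>

definition coproduct :: "graph \<Rightarrow> (graph \<times> graph \<Rightarrow>\<^sub>0 real)" where
  "coproduct \<Gamma> = (\<Sum>j<2. \<Sum>(\<Gamma>1, \<Gamma>2) \<in> (\<lambda>S. (rep (collapse \<Gamma> j S), rep (subgraph \<Gamma> j S))) ` subgraphs \<Gamma> j.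
     Poly_Mapping.single (\<Gamma>1, \<Gamma>2) ((-1) ^ j * graph_coeff \<Gamma> (insertion j \<Gamma>1 \<Gamma>2)))"

definition weight_tensor :: "(graph \<Rightarrow> real) \<Rightarrow> (graph \<times> graph \<Rightarrow>\<^sub>0 real) \<Rightarrow> real" where
  "weight_tensor W t =
     (\<Sum>(\<Gamma>1, \<Gamma>2)\<in>Poly_Mapping.keys t. Poly_Mapping.lookup t (\<Gamma>1, \<Gamma>2) * (W \<Gamma>1 * W \<Gamma>2))"

end

theory Submission
  imports Defs
begin

text \<open>
  The associator of \<open>\<star>\<close> in order \<open>N\<close> is
  \<open>\<Sum>\<Gamma>. W(\<Delta>\<^sub>b \<Gamma>) U\<^sub>\<Gamma>\<close>, the sum over one representative of each nonvanishing class of graphs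
  with three boundary vertices and \<open>N\<close> internal vertices (\<open>associator_eq\<close>). Both directions of the
  theorem are read off from this formula.

  To obtain it, one inserts \<open>f \<star> g\<close> or \<open>g \<star> h\<close> into the operator of a graph. The Leibniz rule
  distributes the derivatives belonging to the edges into the boundary vertex over the factors of the
  inserted operator, so that the result is the sum of the operators of all grafted graphs
  (\<open>graph_operator_graft\<close>). The operator of a labelled graph agrees up to sign with that of its
  representative, by the symmetry of iterated partial derivatives (\<open>pd_commute\<close>) and the antisymmetry
  of \<open>\<alpha>\<close> (\<open>graph_operator_iso\<close>). Collecting the terms of each class gives the coefficients
  \<open>\<Sum> (-1)\<^sup>j W(\<Gamma>1) W(\<Gamma>2)\<close> times the coefficient of \<open>\<Gamma>\<close> in the insertion of \<open>\<Gamma>2\<close> into \<open>\<Gamma>1\<close> at \<open>j\<close>,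
  the sum over all pairs of representatives. The coproduct runs only over the pairs
  coming from subgraphs of \<open>\<Gamma>\<close>, but these include all pairs with a nonzero coefficient: a graph
  isomorphic to a grafted one has the inserted graph as a subgraph, with the other one as its collapse
  (\<open>subgraph_of_graft\<close>). Hence the coefficient is the weight of the coproduct (\<open>weight_coproduct\<close>).

  Conversely, associativity forces each coefficient to vanish because the operators separate the
  classes of graphs as the dimension and \<open>\<alpha>\<close> vary. For a graph \<open>\<Gamma>0\<close> take one coordinate for each edge and,
  as \<open>\<alpha>\<close>, the sum over the internal vertices of the wedge of the two outgoing directions times the
  product of the incoming coordinates; as functions, take the products of the coordinates of the edges
  into the boundary vertices. At the origin, the nonzero terms of the operator of a graph \<open>\<Gamma>\<close> are then
  labellings of its edges which are coverings \<open>\<Gamma> \<rightarrow> \<Gamma>0\<close>. As \<open>\<Gamma>\<close> has no circuits and as many vertices as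
  \<open>\<Gamma>0\<close>, they are isomorphisms, and the terms are their signs (\<open>test_summand_iso\<close>). So the operator of
  \<open>\<Gamma>\<close> gives zero unless \<open>\<Gamma>\<close> is isomorphic to \<open>\<Gamma>0\<close>, and that of \<open>\<Gamma>0\<close> a positive number.
\<close>

section \<open>Isomorphisms of labelled graphs\<close>

abbreviation relabel :: "(nat \<Rightarrow> nat) \<Rightarrow> vertex \<Rightarrow> vertex" where
  "relabel \<sigma> \<equiv> case_vertex (\<lambda>u. Internal (\<sigma> u)) Boundary"

lemma set_edges: "set (edges \<Gamma>) = {..<length \<Gamma>} \<times> UNIV"
  by (auto simp: edges_def)

lemma distinct_edges: "distinct (edges \<Gamma>)"
  by (simp add: edges_def distinct_product)

lemma set_in_edges: "set (in_edges \<Gamma> x) = {e. fst e < length \<Gamma> \<and> target \<Gamma> e = x}"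
  by (auto simp: in_edges_def set_edges)

lemma distinct_in_edges: "distinct (in_edges \<Gamma> x)"
  by (simp add: in_edges_def distinct_edges)

lemma in_vertices_iff [simp]:
  "Internal u \<in> vertices n m \<longleftrightarrow> u < n" "Boundary k \<in> vertices n m \<longleftrightarrow> k < m"
  by (auto simp: vertices_def)

lemma finite_vertices [simp]: "finite (vertices n m)"
  by (simp add: vertices_def)

text \<open>
  Writing the sign as a product over the vertices, and the set of exchanged vertices as a predicate,
  makes signs multiply under composition without counting symmetric differences.
\<close>

lemma iso_iff:
  "iso s \<Gamma> \<Gamma>' \<longleftrightarrow> length \<Gamma>' = length \<Gamma> \<and>
     (\<exists>\<sigma> t. \<sigma> permutes {..<length \<Gamma>} \<and> s = (\<Prod>v<length \<Gamma>. if t v then -1 else 1) \<and>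
        (\<forall>v<length \<Gamma>. \<forall>c. target \<Gamma>' (\<sigma> v, c \<noteq> t v) = relabel \<sigma> (target \<Gamma> (v, c))))"
proof -
  have sgn: "(\<Prod>v<n. if t v then -1 else 1) = (-1::real) ^ card {v. v < n \<and> t v}" for t :: "nat \<Rightarrow> bool" and n
  proof -
    have "(\<Prod>v<n. if t v then -1 else (1::real)) = (\<Prod>v\<in>{v. v < n \<and> t v}. -1)"
      by (rule prod.mono_neutral_cong_right) auto
    then show ?thesis by simp
  qed
  show ?thesis
  proof
    assume "iso s \<Gamma> \<Gamma>'"
    then obtain \<sigma> T where *: "length \<Gamma>' = length \<Gamma>" "\<sigma> permutes {..<length \<Gamma>}" "T \<subseteq> {..<length \<Gamma>}"
      "s = (-1) ^ card T"
      "\<forall>v<length \<Gamma>. \<forall>c. target \<Gamma>' (\<sigma> v, c \<noteq> (v \<in> T)) = relabel \<sigma> (target \<Gamma> (v, c))"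
      unfolding iso_def by blast
    have "T = {v. v < length \<Gamma> \<and> v \<in> T}" using * by auto
    then have "s = (\<Prod>v<length \<Gamma>. if v \<in> T then -1 else 1)"
      using *(4) sgn[of "\<lambda>v. v \<in> T" "length \<Gamma>"] by simp
    then show "length \<Gamma>' = length \<Gamma> \<and>
     (\<exists>\<sigma> t. \<sigma> permutes {..<length \<Gamma>} \<and> s = (\<Prod>v<length \<Gamma>. if t v then -1 else 1) \<and>
        (\<forall>v<length \<Gamma>. \<forall>c. target \<Gamma>' (\<sigma> v, c \<noteq> t v) = relabel \<sigma> (target \<Gamma> (v, c))))"
      using * by (intro conjI exI[of _ \<sigma>] exI[of _ "\<lambda>v. v \<in> T"]) auto
  next
    assume "length \<Gamma>' = length \<Gamma> \<and>
     (\<exists>\<sigma> t. \<sigma> permutes {..<length \<Gamma>} \<and> s = (\<Prod>v<length \<Gamma>. if t v then -1 else 1) \<and>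
        (\<forall>v<length \<Gamma>. \<forall>c. target \<Gamma>' (\<sigma> v, c \<noteq> t v) = relabel \<sigma> (target \<Gamma> (v, c))))"
    then obtain \<sigma> t where *: "length \<Gamma>' = length \<Gamma>" "\<sigma> permutes {..<length \<Gamma>}"
      "s = (-1) ^ card {v. v < length \<Gamma> \<and> t v}"
      "\<forall>v<length \<Gamma>. \<forall>c. target \<Gamma>' (\<sigma> v, c \<noteq> t v) = relabel \<sigma> (target \<Gamma> (v, c))"
      unfolding sgn by blast
    then show "iso s \<Gamma> \<Gamma>'"
      unfolding iso_def
      by (intro conjI exI[of _ \<sigma>] exI[of _ "{v. v < length \<Gamma> \<and> t v}"]) auto
  qed
qed

lemma iso_sign: "iso s \<Gamma> \<Gamma>' \<Longrightarrow> s = 1 \<or> s = -1"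
  unfolding iso_def by (metis neg_one_even_power neg_one_odd_power)

lemma iso_length: "iso s \<Gamma> \<Gamma>' \<Longrightarrow> length \<Gamma>' = length \<Gamma>"
  by (simp add: iso_def)

lemma relabel_relabel: "relabel \<sigma> (relabel \<tau> x) = relabel (\<sigma> \<circ> \<tau>) x"
  by (cases x) auto

lemma iso_refl: "iso 1 \<Gamma> \<Gamma>"
  unfolding iso_iff
  by (intro conjI exI[of _ id] exI[of _ "\<lambda>_. False"]) (auto simp: permutes_id split: vertex.split)

lemma iso_sym:
  assumes "iso s \<Gamma> \<Gamma>'"
  shows "iso s \<Gamma>' \<Gamma>"
proof -
  from assms obtain \<sigma> t where len: "length \<Gamma>' = length \<Gamma>" and p: "\<sigma> permutes {..<length \<Gamma>}"
    and s: "s = (\<Prod>v<length \<Gamma>. if t v then -1 else 1)"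
    and tgt: "\<And>v c. v < length \<Gamma> \<Longrightarrow> target \<Gamma>' (\<sigma> v, c \<noteq> t v) = relabel \<sigma> (target \<Gamma> (v, c))"
    unfolding iso_iff by blast
  have pi: "inv \<sigma> permutes {..<length \<Gamma>}" by (rule permutes_inv[OF p])
  have "s = (\<Prod>v<length \<Gamma>. if t (inv \<sigma> v) then -1 else 1)"
    unfolding s using prod.permute[OF pi, of "\<lambda>v. if t v then -1 else 1"] by (simp add: o_def)
  moreover have "target \<Gamma> (inv \<sigma> v, c \<noteq> t (inv \<sigma> v)) = relabel (inv \<sigma>) (target \<Gamma>' (v, c))"
    if v: "v < length \<Gamma>" for v c
  proof -
    have v': "inv \<sigma> v < length \<Gamma>" using permutes_in_image[OF pi, of v] v by auto
    have "target \<Gamma>' (\<sigma> (inv \<sigma> v), (c \<noteq> t (inv \<sigma> v)) \<noteq> t (inv \<sigma> v)) =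
        relabel \<sigma> (target \<Gamma> (inv \<sigma> v, c \<noteq> t (inv \<sigma> v)))"
      by (rule tgt[OF v'])
    moreover have "((c \<noteq> t (inv \<sigma> v)) \<noteq> t (inv \<sigma> v)) = c" by blast
    ultimately have "target \<Gamma>' (v, c) = relabel \<sigma> (target \<Gamma> (inv \<sigma> v, c \<noteq> t (inv \<sigma> v)))"
      by (simp add: permutes_inverses(1)[OF p])
    then show ?thesis
      by (auto simp: permutes_inverses(2)[OF p] split: vertex.split)
  qed
  ultimately show ?thesis
    unfolding iso_iff using pi len by (auto intro!: exI[of _ "inv \<sigma>"] exI[of _ "\<lambda>v. t (inv \<sigma> v)"])
qed

lemma iso_trans:
  assumes "iso s \<Gamma> \<Gamma>'" "iso s' \<Gamma>' \<Gamma>''"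
  shows "iso (s * s') \<Gamma> \<Gamma>''"
proof -
  from assms(1) obtain \<sigma> t where len: "length \<Gamma>' = length \<Gamma>" and p: "\<sigma> permutes {..<length \<Gamma>}"
    and s: "s = (\<Prod>v<length \<Gamma>. if t v then -1 else 1)"
    and tgt: "\<And>v c. v < length \<Gamma> \<Longrightarrow> target \<Gamma>' (\<sigma> v, c \<noteq> t v) = relabel \<sigma> (target \<Gamma> (v, c))"
    unfolding iso_iff by blast
  from assms(2) obtain \<sigma>' t' where len': "length \<Gamma>'' = length \<Gamma>" and p': "\<sigma>' permutes {..<length \<Gamma>}"
    and s': "s' = (\<Prod>v<length \<Gamma>. if t' v then -1 else 1)"
    and tgt': "\<And>v c. v < length \<Gamma> \<Longrightarrow> target \<Gamma>'' (\<sigma>' v, c \<noteq> t' v) = relabel \<sigma>' (target \<Gamma>' (v, c))"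
    unfolding iso_iff len by blast
  let ?t = "\<lambda>v. t v \<noteq> t' (\<sigma> v)"
  have s'': "s' = (\<Prod>v<length \<Gamma>. if t' (\<sigma> v) then -1 else 1)"
    unfolding s' using prod.permute[OF p, of "\<lambda>v. if t' v then -1 else 1"] by (simp add: o_def)
  have "s * s' = (\<Prod>v<length \<Gamma>. if ?t v then -1 else 1)"
    unfolding s s'' prod.distrib[symmetric] by (rule prod.cong) auto
  moreover have "target \<Gamma>'' ((\<sigma>' \<circ> \<sigma>) v, c \<noteq> ?t v) = relabel (\<sigma>' \<circ> \<sigma>) (target \<Gamma> (v, c))"
    if v: "v < length \<Gamma>" for v c
  proof -
    have v': "\<sigma> v < length \<Gamma>" using permutes_in_image[OF p, of v] v by auto
    have "(c \<noteq> ?t v) = ((c \<noteq> t v) \<noteq> t' (\<sigma> v))" by blast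
    then show ?thesis
      using tgt'[OF v', of "c \<noteq> t v"] tgt[OF v, of c] by (simp add: relabel_relabel)
  qed
  ultimately show ?thesis
    unfolding iso_iff using permutes_compose[OF p p'] len'
    by (auto intro!: exI[of _ "\<sigma>' \<circ> \<sigma>"] exI[of _ ?t])
qed

lemma vanishing_iso:
  assumes "iso s \<Gamma> \<Gamma>'" "vanishing \<Gamma>"
  shows "vanishing \<Gamma>'"
  using iso_trans[OF iso_trans[OF iso_sym[OF assms(1)]] assms(1)] assms iso_sign[OF assms(1)]
  unfolding vanishing_def by force

lemma rep_iso: "\<exists>s. iso s \<Gamma> (rep \<Gamma>)"
  unfolding rep_def by (rule someI_ex) (use iso_refl in blast)

lemma rep_eq:
  assumes "iso s \<Gamma> \<Gamma>'"
  shows "rep \<Gamma> = rep \<Gamma>'"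
proof -
  have "(\<exists>s. iso s \<Gamma> G) \<longleftrightarrow> (\<exists>s. iso s \<Gamma>' G)" for G
    using assms iso_sym iso_trans by blast
  then show ?thesis by (simp add: rep_def)
qed

text \<open>
  Acyclicity is witnessed by a height function decreasing along the edges. In this form it is
  easily carried over to relabelled, grafted and smaller graphs, and it allows induction.
\<close>

lemma graphs_iff:
  "\<Gamma> \<in> graphs n m \<longleftrightarrow> length \<Gamma> = n \<and> (\<forall>v<n. \<forall>c. target \<Gamma> (v, c) \<in> vertices n m) \<and>
     (\<exists>h :: nat \<Rightarrow> nat. \<forall>v<n. \<forall>c u. target \<Gamma> (v, c) = Internal u \<longrightarrow> h u < h v)"
proof -
  let ?r = "{(u, v). \<exists>c. (u, c) \<in> set (edges \<Gamma>) \<and> target \<Gamma> (u, c) = Internal v}"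
  have acyc: "acyclic ?r \<longleftrightarrow> (\<exists>h :: nat \<Rightarrow> nat. \<forall>v<n. \<forall>c u. target \<Gamma> (v, c) = Internal u \<longrightarrow> h u < h v)"
    if len: "length \<Gamma> = n" and tgt: "\<forall>v<n. \<forall>c. target \<Gamma> (v, c) \<in> vertices n m"
  proof
    assume a: "acyclic ?r"
    have "?r \<subseteq> {..<n} \<times> {..<n}"
      using tgt len by (auto simp: set_edges) (metis in_vertices_iff(1))
    then have "finite ?r" by (rule finite_subset) simp
    then have fin: "finite (?r\<^sup>+)" by simp
    have "card (?r\<^sup>+ `` {u}) < card (?r\<^sup>+ `` {v})" if "(v, u) \<in> ?r" for u v
    proof (rule psubset_card_mono)
      show "finite (?r\<^sup>+ `` {v})" using fin by (rule finite_Image)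
      have "u \<in> ?r\<^sup>+ `` {v}" using that by blast
      moreover have "u \<notin> ?r\<^sup>+ `` {u}" using a by (auto simp: acyclic_def)
      moreover have "?r\<^sup>+ `` {u} \<subseteq> ?r\<^sup>+ `` {v}" using that by (auto intro: trancl_into_trancl2)
      ultimately show "?r\<^sup>+ `` {u} \<subset> ?r\<^sup>+ `` {v}" by blast
    qed
    then show "\<exists>h :: nat \<Rightarrow> nat. \<forall>v<n. \<forall>c u. target \<Gamma> (v, c) = Internal u \<longrightarrow> h u < h v"
      by (intro exI[of _ "\<lambda>v. card (?r\<^sup>+ `` {v})"]) (auto simp: set_edges len)
  next
    assume "\<exists>h :: nat \<Rightarrow> nat. \<forall>v<n. \<forall>c u. target \<Gamma> (v, c) = Internal u \<longrightarrow> h u < h v"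
    then obtain h :: "nat \<Rightarrow> nat" where "\<forall>v<n. \<forall>c u. target \<Gamma> (v, c) = Internal u \<longrightarrow> h u < h v"
      by blast
    then have "?r \<subseteq> (inv_image less_than h)\<inverse>" by (auto simp: set_edges len)
    then show "acyclic ?r"
      by (meson acyclic_converse acyclic_subset wf_acyclic wf_inv_image wf_less_than)
  qed
  have "target \<Gamma> ` set (edges \<Gamma>) \<subseteq> vertices n m \<longleftrightarrow> (\<forall>v<n. \<forall>c. target \<Gamma> (v, c) \<in> vertices n m)"
    if "length \<Gamma> = n"
    using that by (auto simp: set_edges)
  then show ?thesis
    unfolding graphs_def mem_Collect_eq using acyc by blast
qed

lemma graphs_length: "\<Gamma> \<in> graphs n m \<Longrightarrow> length \<Gamma> = n"
  unfolding graphs_iff by (elim conjE)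

lemma finite_graphs: "finite (graphs n m)"
proof -
  have fin: "finite {\<Gamma>. set \<Gamma> \<subseteq> vertices n m \<times> vertices n m \<and> length \<Gamma> = n}"
    by (rule finite_lists_length_eq) simp
  have sub: "graphs n m \<subseteq> {\<Gamma>. set \<Gamma> \<subseteq> vertices n m \<times> vertices n m \<and> length \<Gamma> = n}"
  proof
    fix \<Gamma> assume \<Gamma>: "\<Gamma> \<in> graphs n m"
    have "p \<in> vertices n m \<times> vertices n m" if p_in: "p \<in> set \<Gamma>" for p
    proof -
      obtain v where "v < length \<Gamma>" and p: "\<Gamma> ! v = p"
        using p_in unfolding in_set_conv_nth by blast
      then have v: "v < n" using graphs_length[OF \<Gamma>] by simp
      have "p = (target \<Gamma> (v, False), target \<Gamma> (v, True))"
        unfolding p[symmetric] target_def by simp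
      moreover have "target \<Gamma> (v, c) \<in> vertices n m" for c
        using \<Gamma> v unfolding graphs_iff by blast
      ultimately show ?thesis by (simp only: mem_Sigma_iff)
    qed
    then have "set \<Gamma> \<subseteq> vertices n m \<times> vertices n m" by (rule subsetI)
    then show "\<Gamma> \<in> {\<Gamma>. set \<Gamma> \<subseteq> vertices n m \<times> vertices n m \<and> length \<Gamma> = n}"
      unfolding mem_Collect_eq using graphs_length[OF \<Gamma>] by (rule conjI)
  qed
  show ?thesis by (rule finite_subset[OF sub fin])
qed

lemma iso_graphs:
  assumes "iso s \<Gamma> \<Gamma>'" "\<Gamma> \<in> graphs n m"
  shows "\<Gamma>' \<in> graphs n m"
proof -
  have n: "length \<Gamma>' = n" "length \<Gamma> = n"
    using iso_length[OF assms(1)] graphs_length[OF assms(2)] by auto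
  obtain \<sigma> t where p: "\<sigma> permutes {..<n}"
    and tgt: "\<And>v c. v < n \<Longrightarrow> target \<Gamma> (\<sigma> v, c \<noteq> t v) = relabel \<sigma> (target \<Gamma>' (v, c))"
    using iso_sym[OF assms(1)] unfolding iso_iff n by blast
  obtain h :: "nat \<Rightarrow> nat" where tv: "\<And>v c. v < n \<Longrightarrow> target \<Gamma> (v, c) \<in> vertices n m"
    and h: "\<And>v c u. v < n \<Longrightarrow> target \<Gamma> (v, c) = Internal u \<Longrightarrow> h u < h v"
    using assms(2) unfolding graphs_iff by blast
  have lt: "\<sigma> v < n \<longleftrightarrow> v < n" for v using permutes_in_image[OF p, of v] by auto
  have "target \<Gamma>' (v, c) \<in> vertices n m" if "v < n" for v c
  proof -
    have "relabel \<sigma> (target \<Gamma>' (v, c)) \<in> vertices n m"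
      using tv[of "\<sigma> v" "c \<noteq> t v"] that lt unfolding tgt[OF that] by blast
    then show ?thesis by (cases "target \<Gamma>' (v, c)") (simp_all add: lt)
  qed
  moreover have "h (\<sigma> u) < h (\<sigma> v)" if "v < n" "target \<Gamma>' (v, c) = Internal u" for v c u
  proof (rule h)
    show "\<sigma> v < n" using that lt by blast
    show "target \<Gamma> (\<sigma> v, c \<noteq> t v) = Internal (\<sigma> u)"
      unfolding tgt[OF that(1)] that(2) by simp
  qed
  ultimately show ?thesis
    unfolding graphs_iff using n(1) by (intro conjI exI[of _ "\<lambda>v. h (\<sigma> v)"] allI impI)
qed

lemma repsE:
  assumes "\<Gamma> \<in> reps n m"
  obtains \<Gamma>' s where "\<Gamma>' \<in> graphs n m" "\<not> vanishing \<Gamma>'" "\<Gamma> = rep \<Gamma>'" "iso s \<Gamma>' \<Gamma>"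
proof -
  obtain \<Gamma>' where *: "\<Gamma>' \<in> graphs n m" "\<not> vanishing \<Gamma>'" "\<Gamma> = rep \<Gamma>'"
    using assms by (auto simp: reps_def)
  obtain s where "iso s \<Gamma>' (rep \<Gamma>')" using rep_iso[of \<Gamma>'] by (rule exE)
  with * show ?thesis by (intro that) simp_all
qed

lemma reps_graphs: "\<Gamma> \<in> reps n m \<Longrightarrow> \<Gamma> \<in> graphs n m"
  by (elim repsE) (rule iso_graphs)

lemma finite_reps: "finite (reps n m)"
  by (rule finite_subset[OF subsetI finite_graphs]) (rule reps_graphs)

lemma reps_not_vanishing:
  assumes "\<Gamma> \<in> reps n m"
  shows "\<not> vanishing \<Gamma>"
  using assms by (rule repsE) (use vanishing_iso[OF iso_sym] in metis)

lemma rep_in_reps: "\<Gamma> \<in> graphs n m \<Longrightarrow> \<not> vanishing \<Gamma> \<Longrightarrow> rep \<Gamma> \<in> reps n m"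
  by (auto simp: reps_def)

lemma rep_reps:
  assumes "\<Gamma> \<in> reps n m"
  shows "rep \<Gamma> = \<Gamma>"
  using assms by (rule repsE) (metis rep_eq)

text \<open>
  The coordinate of the class of a labelled graph along the class of \<open>\<Gamma>\<close>: the contribution of a
  single graph to \<^const>\<open>graph_coeff\<close>.
\<close>

definition class_coeff :: "graph \<Rightarrow> graph \<Rightarrow> real" where
  "class_coeff \<Gamma> \<Gamma>' =
     (if vanishing \<Gamma> then 0 else if iso 1 \<Gamma> \<Gamma>' then 1 else if iso (-1) \<Gamma> \<Gamma>' then -1 else 0)"

lemma class_coeff_iso:
  assumes "iso s \<Gamma> \<Gamma>'" "\<not> vanishing \<Gamma>"
  shows "class_coeff \<Gamma> \<Gamma>' = s"
proof -
  have "\<not> (iso 1 \<Gamma> \<Gamma>' \<and> iso (-1) \<Gamma> \<Gamma>')"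
    using iso_trans[of 1 \<Gamma> \<Gamma>' "-1" \<Gamma>] iso_sym assms(2) by (auto simp: vanishing_def)
  then show ?thesis using assms iso_sign[OF assms(1)] by (auto simp: class_coeff_def)
qed

lemma class_coeff_nonzero: "class_coeff \<Gamma> \<Gamma>' \<noteq> 0 \<Longrightarrow> \<exists>s. iso s \<Gamma> \<Gamma>'"
  by (auto simp: class_coeff_def split: if_splits)

lemma class_coeff_iso_left:
  assumes "iso s \<Gamma>1 \<Gamma>2"
  shows "class_coeff \<Gamma>2 \<Gamma> = s * class_coeff \<Gamma>1 \<Gamma>"
proof (cases "vanishing \<Gamma>1 \<or> (\<nexists>s'. iso s' \<Gamma>1 \<Gamma>)")
  case True
  have "class_coeff \<Gamma>1 \<Gamma> = 0"
    using True class_coeff_nonzero[of \<Gamma>1 \<Gamma>] by (cases "vanishing \<Gamma>1") (simp_all add: class_coeff_def)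
  moreover have "class_coeff \<Gamma>2 \<Gamma> = 0"
  proof (cases "vanishing \<Gamma>1")
    case True
    then show ?thesis using vanishing_iso[OF assms] by (simp add: class_coeff_def)
  next
    case False
    then have "\<nexists>s'. iso s' \<Gamma>2 \<Gamma>" using True iso_trans[OF assms] by metis
    then show ?thesis using class_coeff_nonzero by metis
  qed
  ultimately show ?thesis by simp
next
  case False
  then obtain s' where s': "iso s' \<Gamma>1 \<Gamma>" by (auto simp only:)
  have "\<not> vanishing \<Gamma>2" using vanishing_iso[OF iso_sym[OF assms]] False by metis
  then have "class_coeff \<Gamma>2 \<Gamma> = s * s'"
    by (rule class_coeff_iso[OF iso_trans[OF iso_sym[OF assms] s']])
  then show ?thesis
    using class_coeff_iso[OF s'] False by simp
qed

text \<open>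
  It is enough to give the bijection on the vertices that exist: outside of them it is extended by
  the identity.
\<close>

lemma iso_of_bij:
  assumes len: "length \<Gamma> = n" "length \<Gamma>' = n" and \<phi>: "bij_betw \<phi> {..<n} {..<n}"
    and tgt: "\<And>v c. v < n \<Longrightarrow> target \<Gamma>' (\<phi> v, c \<noteq> t v) = relabel \<phi> (target \<Gamma> (v, c))"
    and int: "\<And>v c u. v < n \<Longrightarrow> target \<Gamma> (v, c) = Internal u \<Longrightarrow> u < n"
  shows "iso (\<Prod>v<n. if t v then -1 else 1) \<Gamma> \<Gamma>'"
proof -
  define \<sigma> where "\<sigma> = (\<lambda>v. if v < n then \<phi> v else v)"
  have "bij_betw \<sigma> {..<n} {..<n}"
    using \<phi> by (rule bij_betw_cong[THEN iffD1, rotated]) (simp add: \<sigma>_def)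
  then have "\<sigma> permutes {..<n}"
    by (rule bij_imp_permutes) (simp add: \<sigma>_def)
  moreover have "target \<Gamma>' (\<sigma> v, c \<noteq> t v) = relabel \<sigma> (target \<Gamma> (v, c))" if v: "v < n" for v c
    using tgt[OF v, of c] int[OF v, of c] v by (cases "target \<Gamma> (v, c)") (simp_all add: \<sigma>_def)
  ultimately show ?thesis
    unfolding iso_iff len by blast
qed

section \<open>Partial derivatives of smooth functions\<close>

lemma upd_in_Euclidean_space:
  "x \<in> topspace (Euclidean_space d) \<Longrightarrow> i < d \<Longrightarrow> x(i := t) \<in> topspace (Euclidean_space d)"
  by (auto simp: topspace_Euclidean_space)

lemma pd_cong:
  assumes "\<And>y. y \<in> topspace (Euclidean_space d) \<Longrightarrow> f y = g y"
    and "i < d" "x \<in> topspace (Euclidean_space d)"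
  shows "pd i f x = pd i g x"
  unfolding pd_def using assms upd_in_Euclidean_space by simp

lemma pds_Nil [simp]: "pds [] f = f"
  by (simp add: pds_def)

lemma pds_Cons [simp]: "pds (i # is) f = pd i (pds is f)"
  by (simp add: pds_def)

lemma pds_append: "pds (is @ js) f = pds is (pds js f)"
  by (simp add: pds_def)

lemma pds_cong:
  assumes "\<And>y. y \<in> topspace (Euclidean_space d) \<Longrightarrow> f y = g y"
    and "set is \<subseteq> {..<d}" "x \<in> topspace (Euclidean_space d)"
  shows "pds is f x = pds is g x"
  using assms(2,3)
proof (induction "is" arbitrary: x)
  case Nil
  then show ?case using assms(1) by simp
next
  case (Cons i "is")
  then show ?case by (auto intro!: pd_cong[where d = d])
qed

lemma pds_smooth: "f \<in> smooth_functions d \<Longrightarrow> set is \<subseteq> {..<d} \<Longrightarrow> pds is f \<in> smooth_functions d"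
  by (simp add: smooth_functions_def flip: pds_append)

lemma smooth_DERIV:
  assumes "f \<in> smooth_functions d" "i < d" "x \<in> topspace (Euclidean_space d)"
  shows "((\<lambda>t. f (x(i := t))) has_real_derivative pd i f (x(i := t))) (at t)"
proof -
  have "\<forall>i<d. \<forall>x\<in>topspace (Euclidean_space d). (\<lambda>t. pds [] f (x(i := t))) differentiable (at (x i))"
    using assms(1) unfolding smooth_functions_def
    by (auto dest!: spec[of _ "[]"])
  then have "(\<lambda>u. f ((x(i := t))(i := u))) differentiable (at ((x(i := t)) i))"
    using assms upd_in_Euclidean_space by (metis pds_Nil)
  then show ?thesis
    by (simp add: pd_def DERIV_deriv_iff_real_differentiable)
qed

text \<open>
  For Schwarz's theorem: applying the mean value theorem once in each variable expresses the second
  difference over a small square by a value of a mixed derivative inside it. As the second difference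
  is symmetric in the two variables, this can be done for both orders of differentiation.
\<close>

lemma second_difference:
  fixes F :: "real \<Rightarrow> real \<Rightarrow> real"
  assumes s: "\<And>s t. ((\<lambda>s. F s t) has_real_derivative Fs s t) (at s)"
    and st: "\<And>s t. ((\<lambda>t. Fs s t) has_real_derivative Fst s t) (at t)"
    and "h > 0"
  shows "\<exists>\<xi> \<eta>. a < \<xi> \<and> \<xi> < a + h \<and> b < \<eta> \<and> \<eta> < b + h \<and>
    F (a + h) (b + h) - F (a + h) b - F a (b + h) + F a b = h * h * Fst \<xi> \<eta>"
proof -
  have "\<exists>\<xi>. a < \<xi> \<and> \<xi> < a + h \<and> (F (a + h) (b + h) - F (a + h) b) - (F a (b + h) - F a b)
      = (a + h - a) * (Fs \<xi> (b + h) - Fs \<xi> b)"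
    by (rule MVT2) (use \<open>h > 0\<close> in \<open>auto intro!: derivative_eq_intros s\<close>)
  then obtain \<xi> where \<xi>: "a < \<xi>" "\<xi> < a + h"
    "(F (a + h) (b + h) - F (a + h) b) - (F a (b + h) - F a b) = h * (Fs \<xi> (b + h) - Fs \<xi> b)"
    by auto
  have "\<exists>\<eta>. b < \<eta> \<and> \<eta> < b + h \<and> Fs \<xi> (b + h) - Fs \<xi> b = (b + h - b) * Fst \<xi> \<eta>"
    by (rule MVT2) (use \<open>h > 0\<close> in \<open>auto intro!: st\<close>)
  then obtain \<eta> where "b < \<eta>" "\<eta> < b + h" "Fs \<xi> (b + h) - Fs \<xi> b = h * Fst \<xi> \<eta>"
    by auto
  with \<xi> show ?thesis by (intro exI[of _ \<xi>] exI[of _ \<eta>]) (simp add: algebra_simps)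
qed

text \<open>
  As the square shrinks, these values tend to the two mixed derivatives at its corner.
\<close>

lemma mixed_derivatives_eq:
  fixes F :: "real \<Rightarrow> real \<Rightarrow> real"
  assumes s: "\<And>s t. ((\<lambda>s. F s t) has_real_derivative Fs s t) (at s)"
    and t: "\<And>s t. ((\<lambda>t. F s t) has_real_derivative Ft s t) (at t)"
    and st: "\<And>s t. ((\<lambda>t. Fs s t) has_real_derivative Fst s t) (at t)"
    and ts: "\<And>s t. ((\<lambda>s. Ft s t) has_real_derivative Fts s t) (at s)"
    and cst: "isCont (\<lambda>p. Fst (fst p) (snd p)) (a, b)"
    and cts: "isCont (\<lambda>p. Fts (fst p) (snd p)) (a, b)"
  shows "Fst a b = Fts a b"
proof (rule ccontr)
  assume neq: "Fst a b \<noteq> Fts a b"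
  define e where "e = \<bar>Fst a b - Fts a b\<bar> / 2"
  have "e > 0" using neq by (simp add: e_def)
  obtain r1 where r1: "r1 > 0" "\<And>p. dist p (a, b) < r1 \<Longrightarrow> dist (Fst (fst p) (snd p)) (Fst a b) < e"
    using cst \<open>e > 0\<close> unfolding continuous_at_eps_delta by (metis fst_conv snd_conv)
  obtain r2 where r2: "r2 > 0" "\<And>p. dist p (a, b) < r2 \<Longrightarrow> dist (Fts (fst p) (snd p)) (Fts a b) < e"
    using cts \<open>e > 0\<close> unfolding continuous_at_eps_delta by (metis fst_conv snd_conv)
  define h where "h = min r1 r2 / 2"
  have h: "h > 0" "2 * h \<le> r1" "2 * h \<le> r2" using r1 r2 by (auto simp: h_def)
  obtain \<xi> \<eta> where 1: "a < \<xi>" "\<xi> < a + h" "b < \<eta>" "\<eta> < b + h"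
    "F (a + h) (b + h) - F (a + h) b - F a (b + h) + F a b = h * h * Fst \<xi> \<eta>"
    using second_difference[OF s st h(1)] by blast
  obtain \<eta>' \<xi>' where 2: "b < \<eta>'" "\<eta>' < b + h" "a < \<xi>'" "\<xi>' < a + h"
    "F (a + h) (b + h) - F a (b + h) - F (a + h) b + F a b = h * h * Fts \<xi>' \<eta>'"
    using second_difference[of "\<lambda>t s. F s t" "\<lambda>t s. Ft s t" "\<lambda>t s. Fts s t", OF t ts h(1)] by blast
  have "h * h * Fst \<xi> \<eta> = h * h * Fts \<xi>' \<eta>'" using 1(5) 2(5) by linarith
  then have eq: "Fst \<xi> \<eta> = Fts \<xi>' \<eta>'" using h(1) by simp
  have near: "dist (x, y) (a, b) < 2 * h" if "a < x" "x < a + h" "b < y" "y < b + h" for x y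
  proof -
    have "dist (x, y) (a, b) \<le> dist x a + dist y b"
      unfolding dist_Pair_Pair by (rule sqrt_sum_squares_le_sum) auto
    then show ?thesis using that by (simp add: dist_real_def)
  qed
  have "dist (Fst \<xi> \<eta>) (Fst a b) < e"
    using r1(2)[of "(\<xi>, \<eta>)"] near[OF 1(1-4)] h by auto
  moreover have "dist (Fts \<xi>' \<eta>') (Fts a b) < e"
    using r2(2)[of "(\<xi>', \<eta>')"] near[OF 2(3,4,1,2)] h by auto
  ultimately show False
    using eq unfolding e_def dist_real_def by (simp add: abs_if split: if_splits)
qed

lemma pd_commute:
  assumes f: "f \<in> smooth_functions d" and "i < d" "j < d" and x: "x \<in> topspace (Euclidean_space d)"
  shows "pd i (pd j f) x = pd j (pd i f) x"
proof (cases "i = j")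
  case False
  let ?X = "\<lambda>s t. x(i := s, j := t)"
  have swap: "?X s t = x(j := t, i := s)" for s t using False by (rule fun_upd_twist)
  have X: "?X s t \<in> topspace (Euclidean_space d)" for s t
    using x \<open>i < d\<close> \<open>j < d\<close> by (intro upd_in_Euclidean_space)
  have X1: "x(i := s) \<in> topspace (Euclidean_space d)" "x(j := s) \<in> topspace (Euclidean_space d)" for s
    using x \<open>i < d\<close> \<open>j < d\<close> by (auto intro: upd_in_Euclidean_space)
  have fi: "pd i f \<in> smooth_functions d" and fj: "pd j f \<in> smooth_functions d"
    using pds_smooth[OF f, of "[i]"] pds_smooth[OF f, of "[j]"] \<open>i < d\<close> \<open>j < d\<close> by auto
  have fij: "pd i (pd j f) \<in> smooth_functions d" and fji: "pd j (pd i f) \<in> smooth_functions d"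
    using pds_smooth[OF f, of "[i, j]"] pds_smooth[OF f, of "[j, i]"] \<open>i < d\<close> \<open>j < d\<close> by auto
  have cm: "continuous_map euclidean (Euclidean_space d) (\<lambda>p. ?X (fst p) (snd p))"
  proof -
    have "continuous_map euclidean (powertop_real UNIV) (\<lambda>p. ?X (fst p) (snd p))"
      unfolding continuous_map_componentwise_UNIV
    proof
      fix k
      show "continuous_map euclidean euclideanreal (\<lambda>p. ?X (fst p) (snd p) k)"
        by (cases "k = j"; cases "k = i") (auto intro!: continuous_intros)
    qed
    then show ?thesis
      unfolding Euclidean_space_def continuous_map_in_subtopology
      using X by (auto simp: topspace_Euclidean_space)
  qed
  have cont: "isCont (\<lambda>p. g (?X (fst p) (snd p))) q" if "g \<in> smooth_functions d" for g q
  proof -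
    have "continuous_map (Euclidean_space d) euclideanreal g"
      using that unfolding smooth_functions_def by (auto dest!: spec[of _ "[]"])
    from continuous_map_compose[OF cm this] show ?thesis
      by (cases q) (simp add: o_def continuous_on_eq_continuous_at)
  qed
  have "pd j (pd i f) (?X (x i) (x j)) = pd i (pd j f) (?X (x i) (x j))"
  proof (rule mixed_derivatives_eq[where F = "\<lambda>s t. f (?X s t)"
        and Fs = "\<lambda>s t. pd i f (?X s t)" and Ft = "\<lambda>s t. pd j f (?X s t)"
        and Fst = "\<lambda>s t. pd j (pd i f) (?X s t)" and Fts = "\<lambda>s t. pd i (pd j f) (?X s t)"])
    show "((\<lambda>s. f (?X s t)) has_real_derivative pd i f (?X s t)) (at s)" for s t
      using smooth_DERIV[OF f \<open>i < d\<close> X1(2)] by (simp add: swap)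
    show "((\<lambda>t. f (?X s t)) has_real_derivative pd j f (?X s t)) (at t)" for s t
      using smooth_DERIV[OF f \<open>j < d\<close> X1(1)] by simp
    show "((\<lambda>t. pd i f (?X s t)) has_real_derivative pd j (pd i f) (?X s t)) (at t)" for s t
      using smooth_DERIV[OF fi \<open>j < d\<close> X1(1)] by simp
    show "((\<lambda>s. pd j f (?X s t)) has_real_derivative pd i (pd j f) (?X s t)) (at s)" for s t
      using smooth_DERIV[OF fj \<open>i < d\<close> X1(2)] by (simp add: swap)
  qed (use cont fij fji in auto)
  then show ?thesis by simp
qed simp

lemma pds_perm:
  assumes f: "f \<in> smooth_functions d" and "mset is = mset js" and "set is \<subseteq> {..<d}"
    and "x \<in> topspace (Euclidean_space d)"
  shows "pds is f x = pds js f x"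
proof -
  have move: "pds (i # xs @ ys) f y = pds (xs @ i # ys) f y"
    if "insert i (set xs \<union> set ys) \<subseteq> {..<d}" "y \<in> topspace (Euclidean_space d)" for i xs ys y
    using that
  proof (induction xs arbitrary: y)
    case (Cons a xs)
    have "pds (i # (a # xs) @ ys) f y = pd a (pd i (pds (xs @ ys) f)) y"
      using Cons.prems by (simp add: pd_commute[OF pds_smooth[OF f]])
    also have "\<dots> = pd a (pds (xs @ i # ys) f) y"
      using Cons by (auto intro!: pd_cong[where d = d])
    finally show ?case by simp
  qed simp
  show ?thesis
    using assms(2-4)
  proof (induction "is" arbitrary: js x)
    case (Cons i "is")
    have "i \<in> set js" using Cons.prems(1) by (metis list.set_intros(1) set_mset_mset)
    then obtain xs ys where js: "js = xs @ i # ys" by (meson split_list)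
    have sub: "insert i (set xs \<union> set ys) \<subseteq> {..<d}"
      using Cons.prems(1,2) js by (metis Un_insert_right list.simps(15) set_append set_mset_mset)
    have "pds (i # is) f x = pd i (pds (xs @ ys) f) x"
      unfolding pds_Cons using Cons.prems js
      by (intro pd_cong[where d = d] Cons.IH) auto
    also have "\<dots> = pds js f x"
      using move[OF sub] Cons.prems js by simp
    finally show ?case .
  qed simp
qed

section \<open>The Leibniz rule\<close>

lemma pd_sum_prod:
  assumes H: "\<And>a k. a \<in> A \<Longrightarrow> k \<in> K \<Longrightarrow> H a k \<in> smooth_functions d"
    and K: "finite K" and "i < d" "x \<in> topspace (Euclidean_space d)"
  shows "pd i (\<lambda>y. \<Sum>a\<in>A. c a * (\<Prod>k\<in>K. H a k y)) x =
    (\<Sum>a\<in>A. c a * (\<Sum>k\<in>K. \<Prod>k'\<in>K. if k' = k then pd i (H a k') x else H a k' x))"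
proof -
  have D: "((\<lambda>t. \<Prod>k\<in>K. H a k (x(i := t))) has_real_derivative
      (\<Sum>k\<in>K. \<Prod>k'\<in>K. if k' = k then pd i (H a k') x else H a k' x)) (at (x i))"
    if a: "a \<in> A" for a
  proof -
    have "((\<lambda>t. \<Prod>k\<in>K. H a k (x(i := t))) has_real_derivative
      (\<Sum>k\<in>K. pd i (H a k) x * (\<Prod>k'\<in>K - {k}. H a k' (x(i := x i))))) (at (x i))"
      using smooth_DERIV[OF H[OF a] assms(3,4), of _ "x i"]
      by (intro has_field_derivative_prod) (simp add: fun_upd_triv)
    moreover have "pd i (H a k) x * (\<Prod>k'\<in>K - {k}. H a k' (x(i := x i))) =
        (\<Prod>k'\<in>K. if k' = k then pd i (H a k') x else H a k' x)" if "k \<in> K" for k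
      using K that by (simp add: prod.remove[of K k])
    ultimately show ?thesis by simp
  qed
  show ?thesis
    unfolding pd_def[of i "\<lambda>y. \<Sum>a\<in>A. c a * (\<Prod>k\<in>K. H a k y)"]
    by (intro DERIV_imp_deriv DERIV_sum DERIV_cmult D)
qed

text \<open>
  The derivatives are numbered by \<open>es\<close>, because the assignments \<open>\<rho>\<close> of derivatives to factors are
  going to be the reattachments of edges in a grafted graph. Sums of products are treated at once,
  because the derivatives taken first turn a product into a sum of products.
\<close>

lemma pds_sum_prod:
  fixes K :: "'k set" and es :: "'e list"
  assumes H: "\<And>a k. a \<in> A \<Longrightarrow> k \<in> K \<Longrightarrow> H a k \<in> smooth_functions d"
    and A: "finite A" and K: "finite K"
    and "distinct es" "I ` set es \<subseteq> {..<d}" "x \<in> topspace (Euclidean_space d)"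
  shows "pds (map I es) (\<lambda>y. \<Sum>a\<in>A. c a * (\<Prod>k\<in>K. H a k y)) x =
    (\<Sum>a\<in>A. c a * (\<Sum>\<rho>\<in>set es \<rightarrow>\<^sub>E K. \<Prod>k\<in>K. pds (map I (filter (\<lambda>e. \<rho> e = k) es)) (H a k) x))"
  using assms(4-6)
proof (induction es arbitrary: x)
  case Nil
  then show ?case by simp
next
  case (Cons e es)
  let ?P = "set es \<rightarrow>\<^sub>E K"
  let ?H = "\<lambda>(a, \<rho>) k. pds (map I (filter (\<lambda>e. \<rho> e = k) es)) (H a k)"
  let ?T = "\<lambda>a \<rho> k. \<Prod>k'\<in>K. if k' = k then pd (I e) (?H (a, \<rho>) k') x else ?H (a, \<rho>) k' x"
  have e: "e \<notin> set es" "I e < d" and es: "distinct es" "I ` set es \<subseteq> {..<d}"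
    using Cons.prems by auto
  have finP: "finite ?P" by (rule finite_PiE) (auto simp: K)
  have sm: "?H b k \<in> smooth_functions d" if "b \<in> A \<times> ?P" "k \<in> K" for b k
    using that es(2) by (auto split: prod.split intro!: pds_smooth H simp: image_subset_iff)
  have "pds (map I (e # es)) (\<lambda>y. \<Sum>a\<in>A. c a * (\<Prod>k\<in>K. H a k y)) x =
      pd (I e) (\<lambda>y. \<Sum>b\<in>A \<times> ?P. c (fst b) * (\<Prod>k\<in>K. ?H b k y)) x"
    unfolding list.map pds_Cons
    using e Cons.prems(3)
    by (intro pd_cong[where d = d]) (auto simp: Cons.IH[OF es] sum.cartesian_product sum_distrib_left
          intro!: sum.cong)
  also have "\<dots> = (\<Sum>b\<in>A \<times> ?P. c (fst b) *
      (\<Sum>k\<in>K. \<Prod>k'\<in>K. if k' = k then pd (I e) (?H b k') x else ?H b k' x))"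
    by (rule pd_sum_prod) (use sm e K Cons.prems(3) in auto)
  also have "\<dots> = (\<Sum>a\<in>A. c a * (\<Sum>\<rho>\<in>?P. \<Sum>k\<in>K. ?T a \<rho> k))"
    by (simp add: sum.cartesian_product' sum_distrib_left)
  also have "\<dots> = (\<Sum>a\<in>A. c a * (\<Sum>\<rho>\<in>set (e # es) \<rightarrow>\<^sub>E K. \<Prod>k\<in>K.
      pds (map I (filter (\<lambda>e. \<rho> e = k) (e # es))) (H a k) x))"
  proof (rule sum.cong[OF refl])
    fix a assume "a \<in> A"
    have "(\<Sum>\<rho>\<in>set (e # es) \<rightarrow>\<^sub>E K. \<Prod>k\<in>K. pds (map I (filter (\<lambda>e. \<rho> e = k) (e # es))) (H a k) x) =
      (\<Sum>(k, \<rho>)\<in>K \<times> ?P. \<Prod>k'\<in>K. pds (map I (filter (\<lambda>e'. (\<rho>(e := k)) e' = k') (e # es))) (H a k') x)"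
      unfolding list.set PiE_insert_eq
      by (subst sum.reindex[OF inj_combinator[OF e(1)]]) (simp only: case_prod_unfold o_def)
    also have "\<dots> = (\<Sum>(k, \<rho>)\<in>K \<times> ?P. ?T a \<rho> k)"
    proof (rule sum.cong[OF refl])
      fix b :: "'k \<times> ('e \<Rightarrow> 'k)"
      obtain k \<rho> where b: "b = (k, \<rho>)" by fastforce
      have "pds (map I (filter (\<lambda>e'. (\<rho>(e := k)) e' = k') (e # es))) (H a k') x =
          (if k' = k then pd (I e) (?H (a, \<rho>) k') x else ?H (a, \<rho>) k' x)" for k'
      proof -
        have "filter (\<lambda>e'. (\<rho>(e := k)) e' = k') es = filter (\<lambda>e'. \<rho> e' = k') es"
          using e(1) by (intro filter_cong) auto
        then have "map I (filter (\<lambda>e'. (\<rho>(e := k)) e' = k') (e # es)) =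
            (if k' = k then [I e] else []) @ map I (filter (\<lambda>e'. \<rho> e' = k') es)"
          by (simp only: filter.simps) simp
        then show ?thesis by (simp only:) simp
      qed
      then show "(case b of (k, \<rho>) \<Rightarrow> \<Prod>k'\<in>K.
            pds (map I (filter (\<lambda>e'. (\<rho>(e := k)) e' = k') (e # es))) (H a k') x) =
          (case b of (k, \<rho>) \<Rightarrow> ?T a \<rho> k)"
        unfolding b prod.case by (intro prod.cong refl)
    qed
    also have "\<dots> = (\<Sum>\<rho>\<in>?P. \<Sum>k\<in>K. ?T a \<rho> k)"
      by (subst sum.swap) (simp add: sum.cartesian_product)
    finally show "c a * (\<Sum>\<rho>\<in>?P. \<Sum>k\<in>K. ?T a \<rho> k) =
        c a * (\<Sum>\<rho>\<in>set (e # es) \<rightarrow>\<^sub>E K. \<Prod>k\<in>K.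
        pds (map I (filter (\<lambda>e. \<rho> e = k) (e # es))) (H a k) x)"
      by (simp only:)
  qed
  finally show ?case .
qed

section \<open>Monomials\<close>

text \<open>
  Test functions for telling graphs apart: a squarefree monomial has a nonzero iterated derivative at
  the origin exactly if each of its variables is differentiated once and no other variable is.
\<close>

lemma monomial_DERIV:
  fixes c :: real
  assumes "finite S"
  shows "((\<lambda>t. c * (\<Prod>e\<in>S. (x(i := t)) e)) has_real_derivative
    (if i \<in> S then c else 0) * (\<Prod>e\<in>S - {i}. x e)) (at t)"
proof (cases "i \<in> S")
  case True
  have "(\<Prod>e\<in>S. (x(i := t)) e) = t * (\<Prod>e\<in>S - {i}. x e)" for t
    using assms True by (simp add: prod.remove[of S i])
  then show ?thesis using True by (auto intro!: derivative_eq_intros)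
next
  case False
  have "(\<Prod>e\<in>S. (x(i := t)) e) = (\<Prod>e\<in>S. x e)" for t
    using False by (intro prod.cong) auto
  then show ?thesis using False by simp
qed

lemma pds_monomial:
  fixes c :: real
  assumes "finite S"
  shows "pds is (\<lambda>x. c * (\<Prod>e\<in>S. x e)) =
    (\<lambda>x. (if distinct is \<and> set is \<subseteq> S then c else 0) * (\<Prod>e\<in>S - set is. x e))"
proof (induction "is")
  case (Cons i "is")
  let ?c = "if distinct is \<and> set is \<subseteq> S then c else 0"
  have "pd i (\<lambda>x. ?c * (\<Prod>e\<in>S - set is. x e)) x =
      (if i \<in> S - set is then ?c else 0) * (\<Prod>e\<in>S - set is - {i}. x e)" for x
    unfolding pd_def by (rule DERIV_imp_deriv[OF monomial_DERIV]) (use assms in auto)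
  moreover have "S - set is - {i} = S - set (i # is)" by auto
  ultimately show ?case
    by (auto simp: Cons.IH fun_eq_iff)
qed simp

lemma pds_monomial_0:
  fixes c :: real
  assumes "finite S"
  shows "pds is (\<lambda>x. c * (\<Prod>e\<in>S. x e)) (\<lambda>_. 0) = (if distinct is \<and> set is = S then c else 0)"
  using assms by (auto simp: pds_monomial prod_zero_iff)

lemma monomial_smooth:
  fixes c :: real
  assumes "S \<subseteq> {..<d}"
  shows "(\<lambda>x. c * (\<Prod>e\<in>S. x e)) \<in> smooth_functions d"
proof -
  have S: "finite S" using assms finite_subset by auto
  have proj: "continuous_map (Euclidean_space d) euclideanreal (\<lambda>x. x k)" for k
    unfolding Euclidean_space_def
    by (intro continuous_map_from_subtopology continuous_map_product_projection) simp
  have "continuous_map (Euclidean_space d) euclideanreal (\<lambda>x. c' * (\<Prod>e\<in>S - T. x e))"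
    for c' :: real and T
    using S by (intro continuous_map_real_mult continuous_map_prod proj) auto
  moreover have "(\<lambda>t. c' * (\<Prod>e\<in>S - T. (x(i := t)) e)) differentiable (at (x i))"
    for c' :: real and T x i
    using monomial_DERIV[of "S - T" c' x i] S by (auto simp: real_differentiable_def)
  ultimately show ?thesis
    by (simp only: smooth_functions_def pds_monomial[OF S] mem_Collect_eq) blast
qed

section \<open>The operators of graphs\<close>

lemma bivector_field_smooth:
  "bivector_field d \<alpha> \<Longrightarrow> i < d \<Longrightarrow> j < d \<Longrightarrow> \<alpha> i j \<in> smooth_functions d"
  by (simp add: bivector_field_def)

text \<open>The function placed at a vertex when the edges carry the indices \<open>I\<close>.\<close>

definition decoration ::
  "(nat \<Rightarrow> nat \<Rightarrow> (nat \<Rightarrow> real) \<Rightarrow> real) \<Rightarrow> (nat \<Rightarrow> (nat \<Rightarrow> real) \<Rightarrow> real) \<Rightarrow> (nat \<times> bool \<Rightarrow> nat) \<Rightarrow>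
    vertex \<Rightarrow> (nat \<Rightarrow> real) \<Rightarrow> real" where
  "decoration \<alpha> F I = case_vertex (\<lambda>v. \<alpha> (I (v, False)) (I (v, True))) F"

text \<open>
  This is \<^const>\<open>U\<close> with internal and boundary vertices on the same footing and the boundary
  functions given by a family: relabelling and grafting then act on the vertices of a single product.
\<close>

definition graph_operator ::
  "nat \<Rightarrow> (nat \<Rightarrow> nat \<Rightarrow> (nat \<Rightarrow> real) \<Rightarrow> real) \<Rightarrow> nat \<Rightarrow> (nat \<Rightarrow> (nat \<Rightarrow> real) \<Rightarrow> real) \<Rightarrow> graph \<Rightarrow>
    (nat \<Rightarrow> real) \<Rightarrow> real" where
  "graph_operator d \<alpha> m F \<Gamma> x = (\<Sum>I \<in> set (edges \<Gamma>) \<rightarrow>\<^sub>E {..<d}.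
     \<Prod>k\<in>vertices (length \<Gamma>) m. pds (map I (in_edges \<Gamma> k)) (decoration \<alpha> F I k) x)"

lemma prod_vertices:
  "(\<Prod>k\<in>vertices n m. g k) = (\<Prod>v<n. g (Internal v)) * (\<Prod>j<m. g (Boundary j))"
proof -
  have "(\<Prod>k\<in>vertices n m. g k) = prod g (Internal ` {..<n}) * prod g (Boundary ` {..<m})"
    unfolding vertices_def by (rule prod.union_disjoint) auto
  then show ?thesis by (simp add: prod.reindex inj_on_def)
qed

lemma U_eq_graph_operator: "U d \<alpha> \<Gamma> fs = graph_operator d \<alpha> (length fs) (nth fs) \<Gamma>"
  by (rule ext) (simp add: U_def graph_operator_def prod_vertices decoration_def)

lemma graph_operator_cong:
  assumes "\<And>k. k < m \<Longrightarrow> F k = F' k"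
  shows "graph_operator d \<alpha> m F \<Gamma> x = graph_operator d \<alpha> m F' \<Gamma> x"
  using assms unfolding graph_operator_def prod_vertices decoration_def by simp

lemma decoration_smooth:
  assumes "bivector_field d \<alpha>" "\<And>k. k < m \<Longrightarrow> F k \<in> smooth_functions d"
    and "I \<in> {..<n} \<times> UNIV \<rightarrow> {..<d}" "k \<in> vertices n m"
  shows "decoration \<alpha> F I k \<in> smooth_functions d"
  using assms(2,3,4) bivector_field_smooth[OF assms(1)]
  by (auto simp: decoration_def vertices_def Pi_iff)

lemma pds_uminus:
  assumes f: "f \<in> smooth_functions d" and "set is \<subseteq> {..<d}" "x \<in> topspace (Euclidean_space d)"
  shows "pds is (\<lambda>y. - f y) x = - pds is f x"
  using assms(2,3)
proof (induction "is" arbitrary: x)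
  case (Cons i "is")
  have "pds (i # is) (\<lambda>y. - f y) x = pd i (\<lambda>y. - pds is f y) x"
    unfolding pds_Cons using Cons by (intro pd_cong[where d = d]) auto
  also have "\<dots> = - pd i (pds is f) x"
    unfolding pd_def[of i "\<lambda>y. - pds is f y"]
    using smooth_DERIV[OF pds_smooth[OF f], of "is" i x "x i"] Cons.prems
    by (intro DERIV_imp_deriv DERIV_minus) auto
  finally show ?case by simp
qed simp

lemma restrict_comp_PiE:
  assumes "I \<in> E \<rightarrow>\<^sub>E D" "\<And>e. f e \<in> E \<longleftrightarrow> e \<in> E"
  shows "restrict (I \<circ> f) E \<in> E \<rightarrow>\<^sub>E D"
    and "(\<And>e. f (g e) = e) \<Longrightarrow> (\<And>e. g e \<in> E \<longleftrightarrow> e \<in> E) \<Longrightarrow> restrict (restrict (I \<circ> f) E \<circ> g) E = I"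
  using assms by (auto simp: PiE_iff extensional_def fun_eq_iff)

text \<open>
  Renumbering the vertices permutes the summands and, up to the order of the derivatives, the factors; an
  exchange of the two edges leaving a vertex is compensated by the antisymmetry of \<open>\<alpha>\<close>.
\<close>

lemma graph_operator_iso:
  assumes \<alpha>: "bivector_field d \<alpha>" and F: "\<And>k. k < m \<Longrightarrow> F k \<in> smooth_functions d"
    and x: "x \<in> topspace (Euclidean_space d)" and iso: "iso s \<Gamma> \<Gamma>'"
  shows "graph_operator d \<alpha> m F \<Gamma>' x = s * graph_operator d \<alpha> m F \<Gamma> x"
proof -
  define n where "n = length \<Gamma>"
  obtain \<sigma> t where len: "length \<Gamma>' = n" and p: "\<sigma> permutes {..<n}"
    and s: "s = (\<Prod>v<n. if t v then -1 else 1)"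
    and tgt: "\<And>v c. v < n \<Longrightarrow> target \<Gamma>' (\<sigma> v, c \<noteq> t v) = relabel \<sigma> (target \<Gamma> (v, c))"
    using iso unfolding iso_iff n_def by auto
  let ?E = "{..<n} \<times> (UNIV :: bool set)"
  have E: "set (edges \<Gamma>) = ?E" "set (edges \<Gamma>') = ?E" by (simp_all add: set_edges len n_def)
  \<comment> \<open>The bijection of the edges induced by the isomorphism, and its inverse\<close>
  define \<tau> :: "nat \<times> bool \<Rightarrow> nat \<times> bool" where "\<tau> = (\<lambda>(v, c). (\<sigma> v, c \<noteq> t v))"
  define \<tau>' where "\<tau>' = (\<lambda>(v, c). (inv \<sigma> v, c \<noteq> t (inv \<sigma> v)))"
  have lt: "\<sigma> v < n \<longleftrightarrow> v < n" for v using permutes_in_image[OF p, of v] by auto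
  have lt': "inv \<sigma> v < n \<longleftrightarrow> v < n" for v
    using permutes_in_image[OF permutes_inv[OF p], of v] by auto
  have \<tau>\<tau>': "\<tau> (\<tau>' e) = e" "\<tau>' (\<tau> e) = e" for e
    by (auto simp: \<tau>_def \<tau>'_def permutes_inverses[OF p] split: prod.splits)
  have \<tau>E: "\<tau> e \<in> ?E \<longleftrightarrow> e \<in> ?E" "\<tau>' e \<in> ?E \<longleftrightarrow> e \<in> ?E" for e
    by (auto simp: \<tau>_def \<tau>'_def lt lt' split: prod.splits)
  have tgt_\<tau>: "target \<Gamma>' (\<tau> e) = relabel \<sigma> (target \<Gamma> e)" if "e \<in> ?E" for e
    using that tgt by (auto simp: \<tau>_def)
  have inj_relabel: "relabel \<sigma> k = relabel \<sigma> k' \<Longrightarrow> k = k'" for k k'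
    using permutes_inj[OF p] by (auto simp: inj_eq split: vertex.splits)
  have in_mset: "mset (map \<tau> (in_edges \<Gamma> k)) = mset (in_edges \<Gamma>' (relabel \<sigma> k))" for k
  proof -
    have "set (map \<tau> (in_edges \<Gamma> k)) = set (in_edges \<Gamma>' (relabel \<sigma> k))"
    proof (intro equalityI subsetI)
      fix e assume "e \<in> set (map \<tau> (in_edges \<Gamma> k))"
      then show "e \<in> set (in_edges \<Gamma>' (relabel \<sigma> k))"
        using tgt_\<tau> \<tau>E(1) by (auto simp: in_edges_def E)
    next
      fix e assume e: "e \<in> set (in_edges \<Gamma>' (relabel \<sigma> k))"
      then have e': "\<tau>' e \<in> ?E" using \<tau>E(2) by (auto simp: in_edges_def E)
      have "relabel \<sigma> (target \<Gamma> (\<tau>' e)) = relabel \<sigma> k"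
        using tgt_\<tau>[OF e'] e by (simp add: \<tau>\<tau>' in_edges_def)
      then have "target \<Gamma> (\<tau>' e) = k" by (rule inj_relabel)
      then have "\<tau>' e \<in> set (in_edges \<Gamma> k)" using e' by (simp add: in_edges_def E)
      then show "e \<in> set (map \<tau> (in_edges \<Gamma> k))" using \<tau>\<tau>'(1)[of e] by (metis image_eqI list.set_map)
    qed
    moreover have "distinct (map \<tau> (in_edges \<Gamma> k))"
      using distinct_in_edges \<tau>\<tau>'(2) by (metis distinct_map inj_on_inverseI)
    ultimately show ?thesis
      using distinct_in_edges set_eq_iff_mset_eq_distinct by blast
  qed
  define sg :: "vertex \<Rightarrow> real" where
    "sg = case_vertex (\<lambda>v. if t v then -1 else 1) (\<lambda>_. 1)"
  have s': "s = (\<Prod>k\<in>vertices n m. sg k)"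
    by (simp add: prod_vertices sg_def s)
  have bij: "bij_betw (relabel \<sigma>) (vertices n m) (vertices n m)"
  proof (rule bij_betw_byWitness[where f' = "relabel (inv \<sigma>)"])
  qed (auto simp: permutes_inverses[OF p] lt lt' vertices_def)
  have summand: "(\<Prod>k\<in>vertices n m. pds (map I' (in_edges \<Gamma>' k)) (decoration \<alpha> F I' k) x) =
    s * (\<Prod>k\<in>vertices n m. pds (map I (in_edges \<Gamma> k)) (decoration \<alpha> F I k) x)"
    if I': "I' \<in> ?E \<rightarrow>\<^sub>E {..<d}" and I_def: "I = restrict (I' \<circ> \<tau>) ?E" for I I'
  proof -
    have I: "I \<in> ?E \<rightarrow> {..<d}" using I' \<tau>E(1) by (auto simp: I_def)
    have fac: "pds (map I' (in_edges \<Gamma>' (relabel \<sigma> k))) (decoration \<alpha> F I' (relabel \<sigma> k)) x =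
        sg k * pds (map I (in_edges \<Gamma> k)) (decoration \<alpha> F I k) x" if k: "k \<in> vertices n m" for k
    proof -
      have sub: "set (map I (in_edges \<Gamma> k)) \<subseteq> {..<d}" using I by (auto simp: in_edges_def E)
      have "map I (in_edges \<Gamma> k) = map I' (map \<tau> (in_edges \<Gamma> k))"
        by (auto simp: I_def in_edges_def E)
      then have ms: "mset (map I (in_edges \<Gamma> k)) = mset (map I' (in_edges \<Gamma>' (relabel \<sigma> k)))"
        using in_mset[of k] by (metis mset_map)
      have sm: "decoration \<alpha> F I k \<in> smooth_functions d"
        using decoration_smooth[OF \<alpha> F I k] by simp
      have dec: "decoration \<alpha> F I' (relabel \<sigma> k) y = sg k * decoration \<alpha> F I k y"
        if y: "y \<in> topspace (Euclidean_space d)" for y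
      proof (cases k)
        case (Internal v)
        then have v: "v < n" using k by simp
        have "I (v, False) < d" "I (v, True) < d" using I v by (auto simp: Pi_iff)
        then have anti: "\<alpha> (I (v, True)) (I (v, False)) y = - \<alpha> (I (v, False)) (I (v, True)) y"
          using \<alpha> y unfolding bivector_field_def by blast
        show ?thesis
          using v anti by (cases "t v") (simp_all add: Internal decoration_def sg_def I_def \<tau>_def)
      qed (simp add: decoration_def sg_def)
      have "pds (map I' (in_edges \<Gamma>' (relabel \<sigma> k))) (decoration \<alpha> F I' (relabel \<sigma> k)) x =
          pds (map I' (in_edges \<Gamma>' (relabel \<sigma> k))) (\<lambda>y. sg k * decoration \<alpha> F I k y) x"
        using mset_eq_setD[OF ms] sub x dec by (intro pds_cong[where d = d]) auto
      also have "\<dots> = sg k * pds (map I' (in_edges \<Gamma>' (relabel \<sigma> k))) (decoration \<alpha> F I k) x"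
        using pds_uminus[OF sm _ x, of "map I' (in_edges \<Gamma>' (relabel \<sigma> k))"] mset_eq_setD[OF ms] sub
        by (cases k) (auto simp: sg_def)
      also have "\<dots> = sg k * pds (map I (in_edges \<Gamma> k)) (decoration \<alpha> F I k) x"
        using pds_perm[OF sm ms sub x] by simp
      finally show ?thesis .
    qed
    have "(\<Prod>k\<in>vertices n m. pds (map I' (in_edges \<Gamma>' k)) (decoration \<alpha> F I' k) x) =
      (\<Prod>k\<in>vertices n m. pds (map I' (in_edges \<Gamma>' (relabel \<sigma> k))) (decoration \<alpha> F I' (relabel \<sigma> k)) x)"
      by (rule prod.reindex_bij_betw[OF bij, symmetric])
    then show ?thesis
      by (simp add: fac prod.distrib s')
  qed
  have "graph_operator d \<alpha> m F \<Gamma>' x = (\<Sum>I \<in> ?E \<rightarrow>\<^sub>E {..<d}.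
     s * (\<Prod>k\<in>vertices n m. pds (map I (in_edges \<Gamma> k)) (decoration \<alpha> F I k) x))"
    unfolding graph_operator_def E len
  proof (rule sum.reindex_bij_witness[where i = "\<lambda>I. restrict (I \<circ> \<tau>') ?E"
        and j = "\<lambda>I. restrict (I \<circ> \<tau>) ?E"])
    fix I assume I: "I \<in> ?E \<rightarrow>\<^sub>E {..<d}"
    show "restrict (I \<circ> \<tau>) ?E \<in> ?E \<rightarrow>\<^sub>E {..<d}" "restrict (I \<circ> \<tau>') ?E \<in> ?E \<rightarrow>\<^sub>E {..<d}"
      by (intro restrict_comp_PiE I \<tau>E)+
    show "restrict (restrict (I \<circ> \<tau>) ?E \<circ> \<tau>') ?E = I" "restrict (restrict (I \<circ> \<tau>') ?E \<circ> \<tau>) ?E = I"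
      by (rule restrict_comp_PiE(2)[OF I]; fact \<tau>E \<tau>\<tau>')+
    show "s * (\<Prod>k\<in>vertices n m. pds (map (restrict (I \<circ> \<tau>) ?E) (in_edges \<Gamma> k))
        (decoration \<alpha> F (restrict (I \<circ> \<tau>) ?E) k) x) =
      (\<Prod>k\<in>vertices n m. pds (map I (in_edges \<Gamma>' k)) (decoration \<alpha> F I k) x)"
      using summand[OF I refl] by simp
  qed
  then show ?thesis
    unfolding graph_operator_def E by (simp add: sum_distrib_left n_def)
qed

text \<open>
  A vanishing graph has the operator zero, since it is minus itself. For any other graph, only its own
  representative occurs in the sum, with the sign relating the two.
\<close>

lemma graph_operator_reps:
  assumes \<alpha>: "bivector_field d \<alpha>" and F: "\<And>k. k < m \<Longrightarrow> F k \<in> smooth_functions d"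
    and x: "x \<in> topspace (Euclidean_space d)" and \<Gamma>': "\<Gamma>' \<in> graphs n m"
  shows "graph_operator d \<alpha> m F \<Gamma>' x = (\<Sum>\<Gamma>\<in>reps n m. class_coeff \<Gamma> \<Gamma>' * graph_operator d \<alpha> m F \<Gamma> x)"
proof (cases "vanishing \<Gamma>'")
  case True
  then have "graph_operator d \<alpha> m F \<Gamma>' x = - 1 * graph_operator d \<alpha> m F \<Gamma>' x"
    unfolding vanishing_def by (intro graph_operator_iso[OF \<alpha> F x])
  then have "graph_operator d \<alpha> m F \<Gamma>' x = 0" by simp
  moreover have "class_coeff \<Gamma> \<Gamma>' = 0" if "\<Gamma> \<in> reps n m" for \<Gamma>
    using class_coeff_nonzero vanishing_iso[OF iso_sym True] reps_not_vanishing[OF that] by blast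
  ultimately show ?thesis by simp
next
  case False
  obtain s where s: "iso s \<Gamma>' (rep \<Gamma>')" using rep_iso by blast
  have rep: "rep \<Gamma>' \<in> reps n m" by (rule rep_in_reps[OF \<Gamma>' False])
  have "class_coeff \<Gamma> \<Gamma>' = 0" if "\<Gamma> \<in> reps n m - {rep \<Gamma>'}" for \<Gamma>
    using class_coeff_nonzero rep_eq rep_reps that by (metis DiffD1 DiffD2 singletonI)
  then have "(\<Sum>\<Gamma>\<in>reps n m. class_coeff \<Gamma> \<Gamma>' * graph_operator d \<alpha> m F \<Gamma> x) =
      class_coeff (rep \<Gamma>') \<Gamma>' * graph_operator d \<alpha> m F (rep \<Gamma>') x"
    by (subst sum.remove[OF finite_reps rep]) simp
  also have "class_coeff (rep \<Gamma>') \<Gamma>' = s"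
    by (rule class_coeff_iso[OF iso_sym[OF s] reps_not_vanishing[OF rep]])
  also have "s * graph_operator d \<alpha> m F (rep \<Gamma>') x = graph_operator d \<alpha> m F \<Gamma>' x"
    using graph_operator_iso[OF \<alpha> F x iso_sym[OF s], where m = m] by simp
  finally show ?thesis by simp
qed

section \<open>Grafting\<close>

text \<open>
  The vertices of a grafted graph are those of \<open>\<Gamma>2\<close>, placed by \<open>plug_in\<close>, and those of \<open>\<Gamma>1\<close> other
  than the boundary vertex \<open>j\<close>, placed by \<open>make_room\<close>.
\<close>

abbreviation plug_in :: "nat \<Rightarrow> nat \<Rightarrow> vertex \<Rightarrow> vertex" where
  "plug_in a j \<equiv> case_vertex (\<lambda>u. Internal (a + u)) (\<lambda>k. Boundary (j + k))"

abbreviation make_room :: "nat \<Rightarrow> vertex \<Rightarrow> vertex" where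
  "make_room j \<equiv> case_vertex Internal (\<lambda>k. Boundary (if k < j then k else k + 1))"

lemma length_graft [simp]: "length (graft j \<Gamma>1 \<Gamma>2 \<rho>) = length \<Gamma>1 + length \<Gamma>2"
  by (simp add: graft_def Let_def)

lemma target_graft_left:
  assumes "fst e < length \<Gamma>1"
  shows "target (graft j \<Gamma>1 \<Gamma>2 \<rho>) e = (if target \<Gamma>1 e = Boundary j
    then plug_in (length \<Gamma>1) j (\<rho> e) else make_room j (target \<Gamma>1 e))"
proof -
  obtain v c where "e = (v, c)" by fastforce
  then show ?thesis
    using assms by (cases c) (auto simp: graft_def Let_def target_def nth_append split: vertex.split)
qed

lemma target_graft_right:
  assumes "fst e < length \<Gamma>2"
  shows "target (graft j \<Gamma>1 \<Gamma>2 \<rho>) (map_prod ((+) (length \<Gamma>1)) id e) =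
    plug_in (length \<Gamma>1) j (target \<Gamma>2 e)"
  using assms by (auto simp: graft_def Let_def target_def nth_append)

lemma plug_in_eq_iff [simp]: "plug_in a j y = plug_in a j k \<longleftrightarrow> y = k"
  by (cases y; cases k) auto

lemma make_room_eq_iff [simp]: "make_room j y = make_room j k \<longleftrightarrow> y = k"
  by (cases y; cases k) auto

lemma plug_in_neq_make_room:
  "y \<in> vertices b 2 \<Longrightarrow> k \<in> vertices a 2 - {Boundary j} \<Longrightarrow> plug_in a j y \<noteq> make_room j k"
  by (cases y; cases k) auto

lemma graft_in_graphs:
  assumes "\<Gamma>1 \<in> graphs a 2" "\<Gamma>2 \<in> graphs b 2" "j < 2"
    and \<rho>: "\<rho> \<in> set (in_edges \<Gamma>1 (Boundary j)) \<rightarrow> vertices b 2"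
  shows "graft j \<Gamma>1 \<Gamma>2 \<rho> \<in> graphs (a + b) 3"
proof -
  from assms(1) obtain h1 :: "nat \<Rightarrow> nat" where len1: "length \<Gamma>1 = a"
    and t1: "\<And>v c. v < a \<Longrightarrow> target \<Gamma>1 (v, c) \<in> vertices a 2"
    and h1: "\<And>v c u. v < a \<Longrightarrow> target \<Gamma>1 (v, c) = Internal u \<Longrightarrow> h1 u < h1 v"
    unfolding graphs_iff by blast
  from assms(2) obtain h2 :: "nat \<Rightarrow> nat" where len2: "length \<Gamma>2 = b"
    and t2: "\<And>v c. v < b \<Longrightarrow> target \<Gamma>2 (v, c) \<in> vertices b 2"
    and h2: "\<And>v c u. v < b \<Longrightarrow> target \<Gamma>2 (v, c) = Internal u \<Longrightarrow> h2 u < h2 v"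
    unfolding graphs_iff by blast
  let ?G = "graft j \<Gamma>1 \<Gamma>2 \<rho>"
  \<comment> \<open>Edges lead from the first graph to the second but never back: the vertices of the first are
    placed above those of the second.\<close>
  define M where "M = Suc (\<Sum>v<b. h2 v)"
  have M: "h2 v < M" if "v < b" for v
    using member_le_sum[of v "{..<b}" h2] that by (simp add: M_def)
  define h where "h = (\<lambda>v. if v < a then M + h1 v else h2 (v - a))"
  have \<rho>': "\<rho> (v, c) \<in> vertices b 2" if "v < a" "target \<Gamma>1 (v, c) = Boundary j" for v c
    using \<rho> that by (auto simp: set_in_edges len1 Pi_iff)
  have left: "target ?G (v, c) \<in> vertices (a + b) 3 \<and>
      (\<forall>u. target ?G (v, c) = Internal u \<longrightarrow> h u < h v)" if v: "v < a" for v c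
  proof (cases "target \<Gamma>1 (v, c) = Boundary j")
    case True
    then have "target ?G (v, c) = plug_in a j (\<rho> (v, c))"
      using v target_graft_left[of "(v, c)" \<Gamma>1 j \<Gamma>2 \<rho>] unfolding len1 by simp
    then show ?thesis
      using v \<rho>'[OF v True] M \<open>j < 2\<close>
      by (cases "\<rho> (v, c)") (auto simp: h_def intro: trans_less_add1)
  next
    case False
    then have "target ?G (v, c) = make_room j (target \<Gamma>1 (v, c))"
      using v target_graft_left[of "(v, c)" \<Gamma>1 j \<Gamma>2 \<rho>] unfolding len1 by simp
    then show ?thesis
      using v t1[OF v, of c] h1[OF v, of c]
      by (cases "target \<Gamma>1 (v, c)") (auto simp: h_def)
  qed
  have right: "target ?G (a + v, c) \<in> vertices (a + b) 3 \<and>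
      (\<forall>u. target ?G (a + v, c) = Internal u \<longrightarrow> h u < h (a + v))" if v: "v < b" for v c
  proof -
    have "target ?G (a + v, c) = plug_in a j (target \<Gamma>2 (v, c))"
      using v target_graft_right[of "(v, c)" \<Gamma>2 j \<Gamma>1 \<rho>] unfolding len1 len2 by simp
    then show ?thesis
      using v t2[OF v, of c] h2[OF v, of c] \<open>j < 2\<close>
      by (cases "target \<Gamma>2 (v, c)") (auto simp: h_def)
  qed
  have both: "target ?G (v, c) \<in> vertices (a + b) 3 \<and>
      (\<forall>u. target ?G (v, c) = Internal u \<longrightarrow> h u < h v)" if "v < a + b" for v c
    using left[of v c] right[of "v - a" c] that by (cases "v < a") auto
  have "length ?G = a + b" by (simp add: len1 len2)
  moreover have "\<exists>h :: nat \<Rightarrow> nat. \<forall>v<a + b. \<forall>c u. target ?G (v, c) = Internal u \<longrightarrow> h u < h v"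
  proof (intro exI allI impI)
    fix v c u assume "v < a + b" "target ?G (v, c) = Internal u"
    then show "h u < h v" using both[of v c] by blast
  qed
  ultimately show ?thesis
    unfolding graphs_iff using both by (intro conjI allI impI) simp_all
qed

lemma edges_graft:
  "edges (graft j \<Gamma>1 \<Gamma>2 \<rho>) = edges \<Gamma>1 @ map (map_prod ((+) (length \<Gamma>1)) id) (edges \<Gamma>2)"
proof -
  have 1: "List.product (xs @ ys) zs = List.product xs zs @ List.product ys zs"
    for xs ys :: "nat list" and zs :: "bool list"
    by (induction xs) auto
  have 2: "List.product (map f xs) zs = map (map_prod f id) (List.product xs zs)"
    for f :: "nat \<Rightarrow> nat" and xs and zs :: "bool list"
    by (induction xs) auto
  have "[0..<a + b] = [0..<a] @ map ((+) a) [0..<b]" for a b :: nat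
    by (rule nth_equalityI) (auto simp: nth_append)
  then show ?thesis by (simp add: edges_def 1 2)
qed

text \<open>
  The next two lemmas compare lists, not only sets, of incoming edges: at a vertex of \<open>\<Gamma>2\<close> the
  reattached edges of \<open>\<Gamma>1\<close> come first, which is the order in which the operator of \<open>\<Gamma>1\<close>
  differentiates that of \<open>\<Gamma>2\<close>. So grafting does not interchange derivatives.
\<close>

lemma in_edges_graft_left:
  assumes "\<Gamma>1 \<in> graphs a 2" "\<Gamma>2 \<in> graphs b 2"
    and \<rho>: "\<rho> \<in> set (in_edges \<Gamma>1 (Boundary j)) \<rightarrow> vertices b 2"
    and k: "k \<in> vertices a 2 - {Boundary j}"
  shows "in_edges (graft j \<Gamma>1 \<Gamma>2 \<rho>) (make_room j k) = in_edges \<Gamma>1 k"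
proof -
  let ?G = "graft j \<Gamma>1 \<Gamma>2 \<rho>"
  have len1: "length \<Gamma>1 = a" and len2: "length \<Gamma>2 = b"
    and t2: "\<And>v c. v < b \<Longrightarrow> target \<Gamma>2 (v, c) \<in> vertices b 2"
    using assms(1,2) unfolding graphs_iff by blast+
  have "target ?G e = make_room j k \<longleftrightarrow> target \<Gamma>1 e = k" if e: "e \<in> set (edges \<Gamma>1)" for e
  proof (cases "target \<Gamma>1 e = Boundary j")
    case True
    then have "\<rho> e \<in> vertices b 2" using \<rho> e by (intro funcset_mem[OF \<rho>]) (simp add: in_edges_def)
    moreover have "target ?G e = plug_in a j (\<rho> e)"
      using True target_graft_left[of e \<Gamma>1 j \<Gamma>2 \<rho>] e unfolding len1 by (simp add: set_edges len1 mem_Times_iff)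
    ultimately show ?thesis
      using True k plug_in_neq_make_room[OF _ k] by auto
  next
    case False
    then have "target ?G e = make_room j (target \<Gamma>1 e)"
      using target_graft_left[of e \<Gamma>1 j \<Gamma>2 \<rho>] e unfolding len1 by (simp add: set_edges len1 mem_Times_iff)
    then show ?thesis by simp
  qed
  moreover have "target ?G (map_prod ((+) a) id e) \<noteq> make_room j k" if e: "e \<in> set (edges \<Gamma>2)" for e
  proof -
    have "target \<Gamma>2 e \<in> vertices b 2" using e t2[of "fst e" "snd e"] by (simp add: set_edges len2 mem_Times_iff)
    then show ?thesis
      using e target_graft_right[of e \<Gamma>2 j \<Gamma>1 \<rho>] plug_in_neq_make_room[OF _ k]
      unfolding len1 by (simp add: set_edges len2 mem_Times_iff)
  qed
  ultimately show ?thesis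
    by (auto simp: in_edges_def edges_graft len1 filter_empty_conv intro!: filter_cong)
qed

lemma in_edges_graft_right:
  assumes "\<Gamma>1 \<in> graphs a 2" "\<Gamma>2 \<in> graphs b 2"
    and \<rho>: "\<rho> \<in> set (in_edges \<Gamma>1 (Boundary j)) \<rightarrow> vertices b 2"
    and k: "k \<in> vertices b 2"
  shows "in_edges (graft j \<Gamma>1 \<Gamma>2 \<rho>) (plug_in a j k) =
    filter (\<lambda>e. \<rho> e = k) (in_edges \<Gamma>1 (Boundary j)) @ map (map_prod ((+) a) id) (in_edges \<Gamma>2 k)"
proof -
  let ?G = "graft j \<Gamma>1 \<Gamma>2 \<rho>"
  have len1: "length \<Gamma>1 = a" and len2: "length \<Gamma>2 = b"
    and t1: "\<And>v c. v < a \<Longrightarrow> target \<Gamma>1 (v, c) \<in> vertices a 2"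
    using assms(1,2) unfolding graphs_iff by blast+
  have "target ?G e = plug_in a j k \<longleftrightarrow> target \<Gamma>1 e = Boundary j \<and> \<rho> e = k"
    if e: "e \<in> set (edges \<Gamma>1)" for e
  proof (cases "target \<Gamma>1 e = Boundary j")
    case True
    then have "target ?G e = plug_in a j (\<rho> e)"
      using target_graft_left[of e \<Gamma>1 j \<Gamma>2 \<rho>] e unfolding len1 by (simp add: set_edges len1 mem_Times_iff)
    then show ?thesis using True by simp
  next
    case False
    then have "target ?G e = make_room j (target \<Gamma>1 e)"
      using target_graft_left[of e \<Gamma>1 j \<Gamma>2 \<rho>] e unfolding len1 by (simp add: set_edges len1 mem_Times_iff)
    moreover have "target \<Gamma>1 e \<in> vertices a 2" using e t1[of "fst e" "snd e"] by (simp add: set_edges len1 mem_Times_iff)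
    ultimately show ?thesis
      using False plug_in_neq_make_room[OF k, of "target \<Gamma>1 e" a j] by auto
  qed
  then have "filter (\<lambda>e. target ?G e = plug_in a j k) (edges \<Gamma>1) =
      filter (\<lambda>e. \<rho> e = k) (in_edges \<Gamma>1 (Boundary j))"
    unfolding in_edges_def filter_filter by (intro filter_cong) auto
  moreover have "target ?G (map_prod ((+) a) id e) = plug_in a j k \<longleftrightarrow> target \<Gamma>2 e = k"
    if "e \<in> set (edges \<Gamma>2)" for e
    using that target_graft_right[of e \<Gamma>2 j \<Gamma>1 \<rho>]
    unfolding len1 by (simp add: set_edges len2 mem_Times_iff)
  then have "filter (\<lambda>e. target ?G e = plug_in a j k) (map (map_prod ((+) a) id) (edges \<Gamma>2)) =
      map (map_prod ((+) a) id) (in_edges \<Gamma>2 k)"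
    unfolding in_edges_def filter_map o_def by (intro arg_cong[of _ _ "map _"] filter_cong) auto
  ultimately show ?thesis
    by (simp add: in_edges_def[of ?G] edges_graft len1)
qed

lemma vertices_graft:
  assumes "j < 2"
  shows "make_room j ` (vertices a 2 - {Boundary j}) \<inter> plug_in a j ` vertices b 2 = {}"
    and "vertices (a + b) 3 = make_room j ` (vertices a 2 - {Boundary j}) \<union> plug_in a j ` vertices b 2"
proof -
  show "make_room j ` (vertices a 2 - {Boundary j}) \<inter> plug_in a j ` vertices b 2 = {}"
  proof (rule equals0I)
    fix z assume "z \<in> make_room j ` (vertices a 2 - {Boundary j}) \<inter> plug_in a j ` vertices b 2"
    then obtain k y where z: "z = make_room j k" "z = plug_in a j y"
      and ky: "k \<in> vertices a 2 - {Boundary j}" "y \<in> vertices b 2" by (elim IntE imageE)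
    have "plug_in a j y = make_room j k" unfolding z(1)[symmetric] by (rule z(2)[symmetric])
    with plug_in_neq_make_room[OF ky(2,1)] show False by (rule notE)
  qed
  show "vertices (a + b) 3 = make_room j ` (vertices a 2 - {Boundary j}) \<union> plug_in a j ` vertices b 2"
  proof (intro equalityI subsetI)
    fix k assume k: "k \<in> vertices (a + b) 3"
    show "k \<in> make_room j ` (vertices a 2 - {Boundary j}) \<union> plug_in a j ` vertices b 2"
    proof (cases k)
      case (Internal u)
      show ?thesis
      proof (cases "u < a")
        case True
        then show ?thesis using Internal by (intro UnI1 image_eqI[of _ _ k]) auto
      next
        case False
        then show ?thesis
          using Internal k by (intro UnI2 image_eqI[of _ _ "Internal (u - a)"]) auto
      qed
    next
      case (Boundary i)
      then consider "i < j" | "i = j \<or> i = j + 1" | "j + 1 < i" "i < 3" using k by fastforce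
      then show ?thesis
      proof cases
        case 1
        then show ?thesis using Boundary assms by (intro UnI1 image_eqI[of _ _ k]) auto
      next
        case 2
        then show ?thesis
          using Boundary by (intro UnI2 image_eqI[of _ _ "Boundary (i - j)"]) auto
      next
        case 3
        then show ?thesis
          using Boundary by (intro UnI1 image_eqI[of _ _ "Boundary (i - 1)"]) auto
      qed
    qed
  next
    fix k assume "k \<in> make_room j ` (vertices a 2 - {Boundary j}) \<union> plug_in a j ` vertices b 2"
    then show "k \<in> vertices (a + b) 3"
    proof
      assume "k \<in> make_room j ` (vertices a 2 - {Boundary j})"
      then obtain y where "k = make_room j y" "y \<in> vertices a 2" by auto
      then show ?thesis by (cases y) auto
    next
      assume "k \<in> plug_in a j ` vertices b 2"
      then obtain y where "k = plug_in a j y" "y \<in> vertices b 2" by auto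
      then show ?thesis using assms by (cases y) auto
    qed
  qed
qed

text \<open>
  The edges of a grafted graph are those of the two graphs, so its labellings \<open>J\<close> are pairs of
  labellings \<open>I\<close>, \<open>I'\<close>. The product over its vertices splits into those of \<open>\<Gamma>1\<close>, where nothing has
  changed, and those of \<open>\<Gamma>2\<close>, which receive additional derivatives from the reattached edges.
\<close>

lemma graph_operator_graft_graph:
  assumes \<Gamma>1: "\<Gamma>1 \<in> graphs a 2" and \<Gamma>2: "\<Gamma>2 \<in> graphs b 2" and "j < 2"
    and \<rho>: "\<rho> \<in> set (in_edges \<Gamma>1 (Boundary j)) \<rightarrow> vertices b 2"
    and F1: "\<And>k. k \<noteq> j \<Longrightarrow> F1 k = F (if k < j then k else k + 1)"
  shows "graph_operator d \<alpha> 3 F (graft j \<Gamma>1 \<Gamma>2 \<rho>) x =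
    (\<Sum>I\<in>set (edges \<Gamma>1) \<rightarrow>\<^sub>E {..<d}. \<Sum>I'\<in>set (edges \<Gamma>2) \<rightarrow>\<^sub>E {..<d}.
      (\<Prod>k\<in>vertices a 2 - {Boundary j}. pds (map I (in_edges \<Gamma>1 k)) (decoration \<alpha> F1 I k) x) *
      (\<Prod>k\<in>vertices b 2. pds (map I (filter (\<lambda>e. \<rho> e = k) (in_edges \<Gamma>1 (Boundary j))))
        (pds (map I' (in_edges \<Gamma>2 k)) (decoration \<alpha> (\<lambda>k. F (j + k)) I' k)) x))"
proof -
  let ?G = "graft j \<Gamma>1 \<Gamma>2 \<rho>"
  have len: "length \<Gamma>1 = a" "length \<Gamma>2 = b" using \<Gamma>1 \<Gamma>2 graphs_length by auto
  let ?E1 = "{..<a} \<times> (UNIV :: bool set)" and ?E2 = "{..<b} \<times> (UNIV :: bool set)"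
    and ?E = "{..<a + b} \<times> (UNIV :: bool set)"
  have E: "set (edges \<Gamma>1) = ?E1" "set (edges \<Gamma>2) = ?E2" "set (edges ?G) = ?E"
    by (simp_all add: set_edges len)
  let ?sh = "map_prod ((+) a) id :: nat \<times> bool \<Rightarrow> nat \<times> bool"
  let ?join = "\<lambda>(I, I') e. if fst e < a then I e else if fst e < a + b then I' (fst e - a, snd e)
    else (undefined :: nat)"
  let ?S = "\<lambda>J. (restrict J ?E1, restrict (J \<circ> ?sh) ?E2)"
  have "graph_operator d \<alpha> 3 F ?G x = (\<Sum>(I, I')\<in>(?E1 \<rightarrow>\<^sub>E {..<d}) \<times> (?E2 \<rightarrow>\<^sub>E {..<d}).
      (\<Prod>k\<in>vertices a 2 - {Boundary j}. pds (map I (in_edges \<Gamma>1 k)) (decoration \<alpha> F1 I k) x) *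
      (\<Prod>k\<in>vertices b 2. pds (map I (filter (\<lambda>e. \<rho> e = k) (in_edges \<Gamma>1 (Boundary j))))
        (pds (map I' (in_edges \<Gamma>2 k)) (decoration \<alpha> (\<lambda>k. F (j + k)) I' k)) x))"
    unfolding graph_operator_def E length_graft len
  proof (rule sum.reindex_bij_witness[where j = ?S and i = ?join])
    fix J assume J: "J \<in> ?E \<rightarrow>\<^sub>E {..<d}"
    show "?join (?S J) = J"
    proof
      fix e :: "nat \<times> bool"
      obtain v c where e: "e = (v, c)" by fastforce
      show "?join (?S J) e = J e"
        using J by (auto simp: e PiE_iff extensional_def)
    qed
    show "?S J \<in> (?E1 \<rightarrow>\<^sub>E {..<d}) \<times> (?E2 \<rightarrow>\<^sub>E {..<d})"
      using J by (auto simp: PiE_iff)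
    let ?I = "fst (?S J)" and ?I' = "snd (?S J)"
    have left: "pds (map J (in_edges ?G (make_room j k))) (decoration \<alpha> F J (make_room j k)) x =
        pds (map ?I (in_edges \<Gamma>1 k)) (decoration \<alpha> F1 ?I k) x"
      if k: "k \<in> vertices a 2 - {Boundary j}" for k
    proof -
      have "map J (in_edges \<Gamma>1 k) = map ?I (in_edges \<Gamma>1 k)"
        by (auto simp: in_edges_def E)
      moreover have "decoration \<alpha> F J (make_room j k) = decoration \<alpha> F1 ?I k"
        using k F1 by (cases k) (auto simp: decoration_def)
      ultimately show ?thesis
        by (simp only: in_edges_graft_left[OF \<Gamma>1 \<Gamma>2 \<rho> k])
    qed
    have right: "pds (map J (in_edges ?G (plug_in a j k))) (decoration \<alpha> F J (plug_in a j k)) x =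
        pds (map ?I (filter (\<lambda>e. \<rho> e = k) (in_edges \<Gamma>1 (Boundary j))))
          (pds (map ?I' (in_edges \<Gamma>2 k)) (decoration \<alpha> (\<lambda>k. F (j + k)) ?I' k)) x"
      if k: "k \<in> vertices b 2" for k
    proof -
      have "map J (in_edges ?G (plug_in a j k)) =
          map ?I (filter (\<lambda>e. \<rho> e = k) (in_edges \<Gamma>1 (Boundary j))) @ map ?I' (in_edges \<Gamma>2 k)"
        unfolding in_edges_graft_right[OF \<Gamma>1 \<Gamma>2 \<rho> k] by (auto simp: in_edges_def E)
      moreover have "decoration \<alpha> F J (plug_in a j k) = decoration \<alpha> (\<lambda>k. F (j + k)) ?I' k"
        using k by (cases k) (auto simp: decoration_def)
      ultimately show ?thesis by (simp only: pds_append)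
    qed
    have "(\<Prod>k\<in>vertices (a + b) 3. pds (map J (in_edges ?G k)) (decoration \<alpha> F J k) x) =
        (\<Prod>k\<in>vertices a 2 - {Boundary j}.
          pds (map J (in_edges ?G (make_room j k))) (decoration \<alpha> F J (make_room j k)) x) *
        (\<Prod>k\<in>vertices b 2. pds (map J (in_edges ?G (plug_in a j k))) (decoration \<alpha> F J (plug_in a j k)) x)"
      unfolding vertices_graft(2)[OF \<open>j < 2\<close>]
      by (subst prod.union_disjoint[OF _ _ vertices_graft(1)[OF \<open>j < 2\<close>]])
        (simp_all add: prod.reindex inj_on_def)
    then show "(case ?S J of (I, I') \<Rightarrow>
        (\<Prod>k\<in>vertices a 2 - {Boundary j}. pds (map I (in_edges \<Gamma>1 k)) (decoration \<alpha> F1 I k) x) *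
        (\<Prod>k\<in>vertices b 2. pds (map I (filter (\<lambda>e. \<rho> e = k) (in_edges \<Gamma>1 (Boundary j))))
          (pds (map I' (in_edges \<Gamma>2 k)) (decoration \<alpha> (\<lambda>k. F (j + k)) I' k)) x)) =
        (\<Prod>k\<in>vertices (a + b) 3. pds (map J (in_edges ?G k)) (decoration \<alpha> F J k) x)"
      using left right by simp
  next
    fix II assume "II \<in> (?E1 \<rightarrow>\<^sub>E {..<d}) \<times> (?E2 \<rightarrow>\<^sub>E {..<d})"
    then obtain I I' where II: "II = (I, I')" "I \<in> ?E1 \<rightarrow>\<^sub>E {..<d}" "I' \<in> ?E2 \<rightarrow>\<^sub>E {..<d}" by auto
    show "?S (?join II) = II"
      using II(2,3) by (auto simp: II(1) fun_eq_iff PiE_iff extensional_def)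
    show "?join II \<in> ?E \<rightarrow>\<^sub>E {..<d}"
      using II(2,3) by (auto simp: II(1) PiE_iff extensional_def)
  qed
  then show ?thesis
    unfolding E by (simp add: sum.cartesian_product)
qed

text \<open>
  If the function at the boundary vertex \<open>j\<close> is itself produced by graphs, it is a sum of products
  over their vertices. The Leibniz rule distributes the derivatives of the edges into \<open>j\<close> over these
  vertices, which is reattaching the edges in all possible ways.
\<close>

lemma graph_operator_graft:
  assumes \<alpha>: "bivector_field d \<alpha>" and F: "\<And>k. k < 3 \<Longrightarrow> F k \<in> smooth_functions d"
    and x: "x \<in> topspace (Euclidean_space d)"
    and A: "finite A" "A \<subseteq> graphs b 2" and \<Gamma>1: "\<Gamma>1 \<in> graphs a 2" and "j < 2"
    and F1: "\<And>k. k \<noteq> j \<Longrightarrow> F1 k = F (if k < j then k else k + 1)"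
    and F1j: "\<And>y. F1 j y = (\<Sum>\<Gamma>2\<in>A. c \<Gamma>2 * graph_operator d \<alpha> 2 (\<lambda>k. F (j + k)) \<Gamma>2 y)"
  shows "graph_operator d \<alpha> 2 F1 \<Gamma>1 x = (\<Sum>\<Gamma>2\<in>A. c \<Gamma>2 *
    (\<Sum>\<rho>\<in>set (in_edges \<Gamma>1 (Boundary j)) \<rightarrow>\<^sub>E vertices b 2. graph_operator d \<alpha> 3 F (graft j \<Gamma>1 \<Gamma>2 \<rho>) x))"
proof -
  let ?E1 = "{..<a} \<times> (UNIV :: bool set)" and ?E2 = "{..<b} \<times> (UNIV :: bool set)"
  let ?D1 = "?E1 \<rightarrow>\<^sub>E {..<d}" and ?D2 = "?E2 \<rightarrow>\<^sub>E {..<d}"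
  let ?in = "in_edges \<Gamma>1 (Boundary j)"
  let ?P = "set ?in \<rightarrow>\<^sub>E vertices b 2"
  let ?L = "\<lambda>I. \<Prod>k\<in>vertices a 2 - {Boundary j}. pds (map I (in_edges \<Gamma>1 k)) (decoration \<alpha> F1 I k) x"
  let ?H = "\<lambda>(\<Gamma>2, I') k. pds (map I' (in_edges \<Gamma>2 k)) (decoration \<alpha> (\<lambda>k. F (j + k)) I' k)"
  let ?R = "\<lambda>I \<Gamma>2 I' \<rho>. \<Prod>k\<in>vertices b 2. pds (map I (filter (\<lambda>e. \<rho> e = k) ?in)) (?H (\<Gamma>2, I') k) x"
  have len1: "length \<Gamma>1 = a" and E1: "set (edges \<Gamma>1) = ?E1"
    using \<Gamma>1 graphs_length by (auto simp: set_edges)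
  have len2: "length \<Gamma>2 = b" and E2: "set (edges \<Gamma>2) = ?E2" if "\<Gamma>2 \<in> A" for \<Gamma>2
    using A that graphs_length by (auto simp: set_edges)
  have finD: "finite ?D2" by (intro finite_PiE) auto
  have G: "F1 j y = (\<Sum>b'\<in>A \<times> ?D2. c (fst b') * (\<Prod>k\<in>vertices b 2. ?H b' k y))" for y
  proof -
    have "F1 j y = (\<Sum>\<Gamma>2\<in>A. \<Sum>I'\<in>?D2. c \<Gamma>2 * (\<Prod>k\<in>vertices b 2. ?H (\<Gamma>2, I') k y))"
      unfolding F1j graph_operator_def
      by (intro sum.cong refl) (simp add: len2 E2 sum_distrib_left)
    then show ?thesis by (simp add: sum.cartesian_product case_prod_unfold)
  qed
  have der: "pds (map I ?in) (F1 j) x = (\<Sum>b'\<in>A \<times> ?D2. c (fst b') *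
      (\<Sum>\<rho>\<in>?P. \<Prod>k\<in>vertices b 2. pds (map I (filter (\<lambda>e. \<rho> e = k) ?in)) (?H b' k) x))"
    if I: "I \<in> ?D1" for I
  proof -
    have "F1 j = (\<lambda>y. \<Sum>b'\<in>A \<times> ?D2. c (fst b') * (\<Prod>k\<in>vertices b 2. ?H b' k y))"
      using G by blast
    then show ?thesis
    proof (simp only:, intro pds_sum_prod)
      show "?H b' k \<in> smooth_functions d" if b': "b' \<in> A \<times> ?D2" and k: "k \<in> vertices b 2" for b' k
      proof -
        obtain \<Gamma>2 I' where bb: "b' = (\<Gamma>2, I')" "\<Gamma>2 \<in> A" "I' \<in> ?D2" using b' by auto
        have "decoration \<alpha> (\<lambda>k. F (j + k)) I' k \<in> smooth_functions d"
          using bb k \<open>j < 2\<close> by (intro decoration_smooth[OF \<alpha>, of 2 _ _ b] F) (auto simp: PiE_iff)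
        moreover have "set (map I' (in_edges \<Gamma>2 k)) \<subseteq> {..<d}"
          using bb E2[OF bb(2)] by (auto simp: in_edges_def PiE_iff)
        ultimately show ?thesis by (simp add: bb(1) pds_smooth)
      qed
      show "I ` set ?in \<subseteq> {..<d}"
        using I E1 by (auto simp: in_edges_def PiE_iff)
    qed (use A finD x distinct_in_edges in auto)
  qed
  have "graph_operator d \<alpha> 2 F1 \<Gamma>1 x = (\<Sum>I\<in>?D1. ?L I * pds (map I ?in) (F1 j) x)"
    unfolding graph_operator_def E1 len1
  proof (rule sum.cong[OF refl])
    fix I
    have "Boundary j \<in> vertices a 2" using \<open>j < 2\<close> by simp
    then show "(\<Prod>k\<in>vertices a 2. pds (map I (in_edges \<Gamma>1 k)) (decoration \<alpha> F1 I k) x) =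
        ?L I * pds (map I ?in) (F1 j) x"
      by (subst prod.remove[of _ "Boundary j"]) (simp_all add: decoration_def mult.commute)
  qed
  also have "\<dots> = (\<Sum>I\<in>?D1. \<Sum>\<Gamma>2\<in>A. \<Sum>I'\<in>?D2. \<Sum>\<rho>\<in>?P. c \<Gamma>2 * (?L I * ?R I \<Gamma>2 I' \<rho>))"
    by (intro sum.cong refl, subst der, assumption)
      (simp add: sum.cartesian_product' sum_distrib_left mult.left_commute)
  also have "\<dots> = (\<Sum>\<Gamma>2\<in>A. \<Sum>I\<in>?D1. \<Sum>I'\<in>?D2. \<Sum>\<rho>\<in>?P. c \<Gamma>2 * (?L I * ?R I \<Gamma>2 I' \<rho>))"
    by (rule sum.swap)
  also have "\<dots> = (\<Sum>\<Gamma>2\<in>A. \<Sum>I\<in>?D1. \<Sum>\<rho>\<in>?P. \<Sum>I'\<in>?D2. c \<Gamma>2 * (?L I * ?R I \<Gamma>2 I' \<rho>))"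
    by (rule sum.cong[OF refl], rule sum.cong[OF refl], rule sum.swap)
  also have "\<dots> = (\<Sum>\<Gamma>2\<in>A. \<Sum>\<rho>\<in>?P. \<Sum>I\<in>?D1. \<Sum>I'\<in>?D2. c \<Gamma>2 * (?L I * ?R I \<Gamma>2 I' \<rho>))"
    by (rule sum.cong[OF refl], rule sum.swap)
  also have "\<dots> = (\<Sum>\<Gamma>2\<in>A. c \<Gamma>2 * (\<Sum>\<rho>\<in>?P. graph_operator d \<alpha> 3 F (graft j \<Gamma>1 \<Gamma>2 \<rho>) x))"
  proof (rule sum.cong[OF refl])
    fix \<Gamma>2 assume \<Gamma>2: "\<Gamma>2 \<in> A"
    have "graph_operator d \<alpha> 3 F (graft j \<Gamma>1 \<Gamma>2 \<rho>) x = (\<Sum>I\<in>?D1. \<Sum>I'\<in>?D2. ?L I * ?R I \<Gamma>2 I' \<rho>)"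
      if \<rho>: "\<rho> \<in> ?P" for \<rho>
    proof -
      have "\<Gamma>2 \<in> graphs b 2" "\<rho> \<in> set ?in \<rightarrow> vertices b 2" using A \<Gamma>2 \<rho> by auto
      from graph_operator_graft_graph[where F = F and ?F1.0 = F1, OF \<Gamma>1 this(1) \<open>j < 2\<close> this(2) F1,
          of d \<alpha> x] show ?thesis
        unfolding E1 E2[OF \<Gamma>2] by simp
    qed
    then show "(\<Sum>\<rho>\<in>?P. \<Sum>I\<in>?D1. \<Sum>I'\<in>?D2. c \<Gamma>2 * (?L I * ?R I \<Gamma>2 I' \<rho>)) =
        c \<Gamma>2 * (\<Sum>\<rho>\<in>?P. graph_operator d \<alpha> 3 F (graft j \<Gamma>1 \<Gamma>2 \<rho>) x)"
      by (simp add: sum_distrib_left)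
  qed
  finally show ?thesis .
qed

section \<open>The coproduct\<close>

text \<open>
  Both \<^const>\<open>graph_coeff\<close> and \<^const>\<open>weight_tensor\<close> have the form of the following two lemmas: a
  linear functional given by its values on a basis.
\<close>

lemma lookup_functional_sum:
  assumes "finite X"
  shows "(\<Sum>k\<in>Poly_Mapping.keys (\<Sum>x\<in>X. f x). Poly_Mapping.lookup (\<Sum>x\<in>X. f x) k * (c k :: real)) =
    (\<Sum>x\<in>X. \<Sum>k\<in>Poly_Mapping.keys (f x). Poly_Mapping.lookup (f x) k * c k)"
proof -
  let ?A = "\<Union>x\<in>X. Poly_Mapping.keys (f x)"
  have fin: "finite ?A" using assms by simp
  have "(\<Sum>k\<in>Poly_Mapping.keys (\<Sum>x\<in>X. f x). Poly_Mapping.lookup (\<Sum>x\<in>X. f x) k * c k) =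
      (\<Sum>k\<in>?A. Poly_Mapping.lookup (\<Sum>x\<in>X. f x) k * c k)"
    by (intro sum.mono_neutral_left fin keys_sum) (auto simp: in_keys_iff)
  also have "\<dots> = (\<Sum>x\<in>X. \<Sum>k\<in>?A. Poly_Mapping.lookup (f x) k * c k)"
    unfolding lookup_sum sum_distrib_right by (rule sum.swap)
  also have "\<dots> = (\<Sum>x\<in>X. \<Sum>k\<in>Poly_Mapping.keys (f x). Poly_Mapping.lookup (f x) k * c k)"
    by (intro sum.cong refl sum.mono_neutral_right fin) (auto simp: in_keys_iff)
  finally show ?thesis .
qed

lemma lookup_functional_single:
  "(\<Sum>k\<in>Poly_Mapping.keys (Poly_Mapping.single y v). Poly_Mapping.lookup (Poly_Mapping.single y v) k * (c k :: real))
    = v * c y"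
  by (cases "v = 0") auto

lemma graph_coeff_insertion:
  "graph_coeff \<Gamma> (insertion j \<Gamma>1 \<Gamma>2) =
    (\<Sum>\<rho>\<in>set (in_edges \<Gamma>1 (Boundary j)) \<rightarrow>\<^sub>E vertices (length \<Gamma>2) 2. class_coeff \<Gamma> (graft j \<Gamma>1 \<Gamma>2 \<rho>))"
proof -
  have "finite (set (in_edges \<Gamma>1 (Boundary j)) \<rightarrow>\<^sub>E vertices (length \<Gamma>2) 2)"
    by (intro finite_PiE) auto
  then show ?thesis
    unfolding graph_coeff_def insertion_def class_coeff_def[symmetric]
    by (simp only: lookup_functional_sum lookup_functional_single mult_1)
qed

lemma finite_subgraphs: "finite (subgraphs \<Gamma> j)"
  by (rule finite_subset[of _ "Pow {..<length \<Gamma>}"]) (auto simp: subgraphs_def)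

lemma weight_tensor_coproduct:
  "weight_tensor W (coproduct \<Gamma>) = (\<Sum>j<2. (-1) ^ j *
    (\<Sum>p \<in> (\<lambda>S. (rep (collapse \<Gamma> j S), rep (subgraph \<Gamma> j S))) ` subgraphs \<Gamma> j.
      W (fst p) * W (snd p) * graph_coeff \<Gamma> (insertion j (fst p) (snd p))))"
proof -
  have fin: "finite ((\<lambda>S. (rep (collapse \<Gamma> j S), rep (subgraph \<Gamma> j S))) ` subgraphs \<Gamma> j)" for j
    by (intro finite_imageI finite_subgraphs)
  have "weight_tensor W (coproduct \<Gamma>) =
      (\<Sum>p\<in>Poly_Mapping.keys (coproduct \<Gamma>). Poly_Mapping.lookup (coproduct \<Gamma>) p * (W (fst p) * W (snd p)))"
    unfolding weight_tensor_def by (intro sum.cong) auto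
  then show ?thesis
    unfolding coproduct_def case_prod_unfold
    by (simp only: lookup_functional_sum[OF fin] lookup_functional_sum[OF finite_lessThan]
        lookup_functional_single) (simp add: sum_distrib_left mult_ac)
qed

lemma rank_sorted_list:
  assumes "finite S"
  shows "i < card S \<Longrightarrow> rank S (sorted_list_of_set S ! i) = i"
    and "u \<in> S \<Longrightarrow> rank S u < card S \<and> sorted_list_of_set S ! rank S u = u"
proof -
  let ?xs = "sorted_list_of_set S"
  have xs: "set ?xs = S" "length ?xs = card S" "sorted ?xs" "distinct ?xs"
    using assms by auto
  show rank: "rank S (?xs ! i) = i" if i: "i < card S" for i
  proof -
    have "{w \<in> S. w < ?xs ! i} = (!) ?xs ` {..<i}"
    proof (intro equalityI subsetI)
      fix w assume w: "w \<in> {w \<in> S. w < ?xs ! i}"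
      then have "w \<in> set ?xs" using xs(1) by simp
      then obtain k where k: "k < card S" "w = ?xs ! k" using xs(2) by (metis in_set_conv_nth)
      have "k < i"
      proof (rule ccontr)
        assume "\<not> k < i"
        then have "?xs ! i \<le> ?xs ! k" using xs k by (intro sorted_nth_mono) auto
        then show False using w k by simp
      qed
      then show "w \<in> (!) ?xs ` {..<i}" using k by blast
    next
      fix w assume "w \<in> (!) ?xs ` {..<i}"
      then obtain k where k: "k < i" "w = ?xs ! k" by blast
      then have "w \<in> S" using xs i by (metis nth_mem order_less_trans)
      moreover have "?xs ! k < ?xs ! i"
        using k(1) i by (intro strict_sorted_list_of_set[THEN sorted_wrt_nth_less]) auto
      ultimately show "w \<in> {w \<in> S. w < ?xs ! i}" using k by simp
    qed
    moreover have "inj_on ((!) ?xs) {..<i}"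
      using xs i by (intro inj_on_nth) auto
    ultimately show ?thesis by (simp add: rank_def card_image)
  qed
  show "rank S u < card S \<and> ?xs ! rank S u = u" if "u \<in> S"
  proof -
    obtain i where i: "i < card S" "?xs ! i = u"
      using \<open>u \<in> S\<close> xs(1,2) by (metis in_set_conv_nth)
    then show ?thesis using rank[OF i(1)] by simp
  qed
qed

text \<open>
  The isomorphism identifies the copy of \<open>\<Gamma>2\<close> inside the grafted graph with a set \<open>S\<close> of vertices of \<open>\<Gamma>\<close>.
  Up to the numbering, the subgraph on \<open>S\<close> is \<open>\<Gamma>2\<close>, and collapsing \<open>S\<close> together with \<open>j\<close> and \<open>j + 1\<close> undoes
  the reattachment. So every pair of classes that contributes to the composition is seen by the
  coproduct.
\<close>

lemma subgraph_of_graft: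
  assumes \<Gamma>1: "\<Gamma>1 \<in> graphs a 2" and \<Gamma>2: "\<Gamma>2 \<in> graphs b 2" and "j < 2"
    and \<rho>: "\<rho> \<in> set (in_edges \<Gamma>1 (Boundary j)) \<rightarrow> vertices b 2"
    and iso: "iso s \<Gamma> (graft j \<Gamma>1 \<Gamma>2 \<rho>)"
  shows "\<exists>S\<in>subgraphs \<Gamma> j. rep (collapse \<Gamma> j S) = rep \<Gamma>1 \<and> rep (subgraph \<Gamma> j S) = rep \<Gamma>2"
proof -
  let ?G = "graft j \<Gamma>1 \<Gamma>2 \<rho>"
  have len1: "length \<Gamma>1 = a" and len2: "length \<Gamma>2 = b"
    and t1: "\<And>v c. v < a \<Longrightarrow> target \<Gamma>1 (v, c) \<in> vertices a 2"
    and t2: "\<And>v c. v < b \<Longrightarrow> target \<Gamma>2 (v, c) \<in> vertices b 2"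
    using \<Gamma>1 \<Gamma>2 unfolding graphs_iff by blast+
  have len: "length \<Gamma> = a + b" using iso_length[OF iso] by (simp add: len1 len2)
  obtain \<sigma> t where p: "\<sigma> permutes {..<a + b}"
    and tgt: "\<And>v c. v < a + b \<Longrightarrow> target ?G (\<sigma> v, c \<noteq> t v) = relabel \<sigma> (target \<Gamma> (v, c))"
    using iso unfolding iso_iff len by blast
  have lt: "\<sigma> v < a + b \<longleftrightarrow> v < a + b" for v using permutes_in_image[OF p, of v] by auto
  define S where "S = {u. u < a + b \<and> a \<le> \<sigma> u}"
  define R where "R = {u. u < a + b \<and> \<sigma> u < a}"
  have R: "{..<length \<Gamma>} - S = R" by (auto simp: R_def S_def len)
  have finS: "finite S" and finR: "finite R" by (auto simp: S_def R_def)
  have surj: "\<exists>u. \<sigma> u = w" for w using permutes_surj[OF p] by (metis surjD)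
  have bijS: "bij_betw (\<lambda>u. \<sigma> u - a) S {..<b}"
    unfolding bij_betw_def
  proof
    show "inj_on (\<lambda>u. \<sigma> u - a) S"
    proof (rule inj_onI)
      fix u u' assume "u \<in> S" "u' \<in> S" "\<sigma> u - a = \<sigma> u' - a"
      then have "\<sigma> u = \<sigma> u'" by (auto simp: S_def)
      then show "u = u'" using permutes_inj[OF p] by (simp add: inj_eq)
    qed
    show "(\<lambda>u. \<sigma> u - a) ` S = {..<b}"
    proof (intro equalityI subsetI)
      fix w assume "w \<in> (\<lambda>u. \<sigma> u - a) ` S"
      then obtain u where "w = \<sigma> u - a" "u < a + b" "a \<le> \<sigma> u" by (auto simp: S_def)
      then show "w \<in> {..<b}" using lt[of u] by auto
    next
      fix w assume w: "w \<in> {..<b}"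
      obtain u where u: "\<sigma> u = a + w" using surj by blast
      then have "u \<in> S" using lt[of u] w by (simp add: S_def)
      then show "w \<in> (\<lambda>u. \<sigma> u - a) ` S" using u by (intro image_eqI[of _ _ u]) simp_all
    qed
  qed
  have bijR: "bij_betw \<sigma> R {..<a}"
    unfolding bij_betw_def
  proof
    show "inj_on \<sigma> R" using permutes_inj[OF p] by (rule inj_on_subset) simp
    show "\<sigma> ` R = {..<a}"
    proof (intro equalityI subsetI)
      fix w assume w: "w \<in> {..<a}"
      obtain u where u: "\<sigma> u = w" using surj by blast
      then have "u \<in> R" using lt[of u] w by (simp add: R_def)
      then show "w \<in> \<sigma> ` R" using u by blast
    qed (auto simp: R_def)
  qed
  have cardS: "card S = b" using bij_betw_same_card[OF bijS] by simp
  have cardR: "card R = a" using bij_betw_same_card[OF bijR] by simp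
  let ?xs = "sorted_list_of_set S" and ?ys = "sorted_list_of_set R"
  have xs: "bij_betw ((!) ?xs) {..<b} S" and ys: "bij_betw ((!) ?ys) {..<a} R"
    using finS finR cardS cardR by (auto intro!: bij_betw_nth)
  have inS: "?xs ! i \<in> S" if "i < b" for i using xs that by (auto simp: bij_betw_def)
  have inR: "?ys ! i \<in> R" if "i < a" for i using ys that by (auto simp: bij_betw_def)

  let ?r = "case_vertex (\<lambda>u. Internal (rank S u)) (\<lambda>k. Boundary (k - j))"
  have lenS: "length (subgraph \<Gamma> j S) = b"
    by (simp add: subgraph_def Let_def cardS)
  have tS: "target (subgraph \<Gamma> j S) (i, c) = ?r (target \<Gamma> (?xs ! i, c))" if "i < b" for i c
    using that by (cases c) (simp_all add: subgraph_def Let_def target_def cardS)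
  let ?\<phi> = "\<lambda>i. \<sigma> (?xs ! i) - a"
  \<comment> \<open>The edges leaving \<open>S\<close> correspond to those of \<open>\<Gamma>2\<close>, so they stay in \<open>S\<close> or end at \<open>j\<close> or
    \<open>j + 1\<close>.\<close>
  have edgeS: "target \<Gamma> (?xs ! i, c) \<in> Internal ` S \<union> {Boundary j, Boundary (j + 1)} \<and>
      target \<Gamma>2 (?\<phi> i, c \<noteq> t (?xs ! i)) = relabel ?\<phi> (?r (target \<Gamma> (?xs ! i, c)))"
    if i: "i < b" for i c
  proof -
    let ?u = "?xs ! i" and ?y = "target \<Gamma>2 (?\<phi> i, c \<noteq> t (?xs ! i))"
    have u: "?u < a + b" "a \<le> \<sigma> ?u" using inS[OF i] by (auto simp: S_def)
    then have \<phi>: "?\<phi> i < b" "a + ?\<phi> i = \<sigma> ?u" using lt[of ?u] by auto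
    have eq: "plug_in a j ?y = relabel \<sigma> (target \<Gamma> (?u, c))"
      using target_graft_right[of "(?\<phi> i, c \<noteq> t ?u)" \<Gamma>2 j \<Gamma>1 \<rho>] \<phi> tgt[OF u(1), of c]
      unfolding len1 len2 by simp
    show ?thesis
    proof (cases ?y)
      case (Internal w)
      then have "w < b" using t2[OF \<phi>(1), of "c \<noteq> t ?u"] by simp
      obtain u' where u': "target \<Gamma> (?u, c) = Internal u'" "\<sigma> u' = a + w"
        using eq unfolding Internal by (cases "target \<Gamma> (?u, c)") auto
      then have "u' \<in> S" using lt[of u'] \<open>w < b\<close> by (simp add: S_def)
      then show ?thesis
        using rank_sorted_list(2)[OF finS, of u'] u' Internal by simp
    next
      case (Boundary k)
      then have "k < 2" using t2[OF \<phi>(1), of "c \<noteq> t ?u"] by simp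
      moreover have "target \<Gamma> (?u, c) = Boundary (j + k)"
        using eq unfolding Boundary by (cases "target \<Gamma> (?u, c)") auto
      ultimately show ?thesis using Boundary by (auto simp: less_2_cases_iff)
    qed
  qed
  have "iso (\<Prod>v<b. if t (?xs ! v) then -1 else 1) (subgraph \<Gamma> j S) \<Gamma>2"
  proof (rule iso_of_bij[OF lenS len2, where \<phi> = ?\<phi>])
    show "bij_betw ?\<phi> {..<b} {..<b}"
      using bij_betw_trans[OF xs bijS] by (simp add: o_def)
    show "target \<Gamma>2 (?\<phi> v, c \<noteq> t (?xs ! v)) = relabel ?\<phi> (target (subgraph \<Gamma> j S) (v, c))"
      if "v < b" for v c
      unfolding tS[OF that] using edgeS[OF that] by (rule conjunct2)
    show "u < b" if "v < b" "target (subgraph \<Gamma> j S) (v, c) = Internal u" for v c u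
      using edgeS[OF that(1), of c] that(2) rank_sorted_list(2)[OF finS] unfolding tS[OF that(1)]
      by (auto simp: cardS)
  qed
  then obtain s2 where iso2: "iso s2 (subgraph \<Gamma> j S) \<Gamma>2" by (rule that)

  let ?q = "case_vertex (\<lambda>u. if u \<in> S then Boundary j else Internal (rank R u))
    (\<lambda>k. Boundary (if k \<le> j then k else k - 1))"
  have lenR: "length (collapse \<Gamma> j S) = a"
    by (simp add: collapse_def Let_def R cardR)
  have tR: "target (collapse \<Gamma> j S) (i, c) = ?q (target \<Gamma> (?ys ! i, c))" if "i < a" for i c
    using that by (cases c) (simp_all add: collapse_def Let_def R target_def cardR)
  let ?\<psi> = "\<lambda>i. \<sigma> (?ys ! i)"
  \<comment> \<open>The edges of \<open>\<Gamma>1\<close> into \<open>j\<close> have been reattached to \<open>S\<close>, \<open>j\<close> or \<open>j + 1\<close>, which are all collapsed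
    to \<open>j\<close>. All other edges of \<open>\<Gamma>1\<close> keep their ends up to the numbering.\<close>
  have edgeR: "target \<Gamma>1 (?\<psi> i, c \<noteq> t (?ys ! i)) = relabel ?\<psi> (?q (target \<Gamma> (?ys ! i, c))) \<and>
      (\<forall>u. ?q (target \<Gamma> (?ys ! i, c)) = Internal u \<longrightarrow> u < a)"
    if i: "i < a" for i c
  proof -
    let ?u = "?ys ! i" and ?e = "(?\<psi> i, c \<noteq> t (?ys ! i))"
    let ?y = "target \<Gamma>1 ?e" and ?z = "target \<Gamma> (?u, c)"
    have u: "?u < a + b" "\<sigma> ?u < a" using inR[OF i] by (auto simp: R_def)
    have y: "?y \<in> vertices a 2" by (rule t1[OF u(2)])
    have eq: "(if ?y = Boundary j then plug_in a j (\<rho> ?e) else make_room j ?y) = relabel \<sigma> ?z"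
      using target_graft_left[of ?e \<Gamma>1 j \<Gamma>2 \<rho>] u(2) tgt[OF u(1), of c]
      unfolding len1 len2 by simp
    show ?thesis
    proof (cases "?y = Boundary j")
      case True
      then have "\<rho> ?e \<in> vertices b 2"
        using u(2) by (intro funcset_mem[OF \<rho>]) (simp add: set_in_edges len1)
      then have "?q ?z = Boundary j"
      proof (cases "\<rho> ?e")
        case (Internal w)
        then have "w < b" using \<open>\<rho> ?e \<in> _\<close> by simp
        obtain u' where u': "?z = Internal u'" "\<sigma> u' = a + w"
          using eq True unfolding Internal by (cases ?z) auto
        then have "u' \<in> S" using lt[of u'] \<open>w < b\<close> by (simp add: S_def)
        then show ?thesis using u' by simp
      next
        case (Boundary k)
        then have "k < 2" using \<open>\<rho> ?e \<in> _\<close> by simp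
        moreover have "?z = Boundary (j + k)"
          using eq True unfolding Boundary by (cases ?z) auto
        ultimately show ?thesis by (auto simp: less_2_cases_iff)
      qed
      then show ?thesis using True by simp
    next
      case False
      then have eq': "make_room j ?y = relabel \<sigma> ?z" using eq by simp
      show ?thesis
      proof (cases ?y)
        case (Internal w)
        then have "w < a" using y by simp
        obtain u' where u': "?z = Internal u'" "\<sigma> u' = w"
          using eq' unfolding Internal by (cases ?z) auto
        then have "u' \<in> R" "u' \<notin> S" using lt[of u'] \<open>w < a\<close> by (simp_all add: R_def S_def)
        then show ?thesis
          using rank_sorted_list(2)[OF finR, of u'] u' Internal by (simp add: cardR)
      next
        case (Boundary k)
        then have "k \<noteq> j" using False by simp
        moreover have "?z = Boundary (if k < j then k else k + 1)"
          using eq' unfolding Boundary by (cases ?z) auto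
        ultimately show ?thesis using Boundary by auto
      qed
    qed
  qed
  have "iso (\<Prod>v<a. if t (?ys ! v) then -1 else 1) (collapse \<Gamma> j S) \<Gamma>1"
  proof (rule iso_of_bij[OF lenR len1, where \<phi> = ?\<psi>])
    show "bij_betw ?\<psi> {..<a} {..<a}"
      using bij_betw_trans[OF ys bijR] by (simp add: o_def)
    show "target \<Gamma>1 (?\<psi> v, c \<noteq> t (?ys ! v)) = relabel ?\<psi> (target (collapse \<Gamma> j S) (v, c))"
      if "v < a" for v c
      unfolding tR[OF that] using edgeR[OF that] by (rule conjunct1)
    show "u < a" if "v < a" "target (collapse \<Gamma> j S) (v, c) = Internal u" for v c u
      using edgeR[OF that(1), of c] that(2) unfolding tR[OF that(1)] by blast
  qed
  then obtain s1 where iso1: "iso s1 (collapse \<Gamma> j S) \<Gamma>1" by (rule that)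

  have "S \<in> subgraphs \<Gamma> j"
    unfolding subgraphs_def
  proof (intro CollectI conjI ballI allI)
    show "S \<subseteq> {..<length \<Gamma>}" by (auto simp: S_def len)
    show "subgraph \<Gamma> j S \<in> graphs (card S) 2"
      unfolding cardS by (rule iso_graphs[OF iso_sym[OF iso2] \<Gamma>2])
    show "collapse \<Gamma> j S \<in> graphs (length \<Gamma> - card S) 2"
      using iso_graphs[OF iso_sym[OF iso1] \<Gamma>1] by (simp add: cardS len)
    fix v c assume "v \<in> S"
    then obtain i where "i < b" "v = ?xs ! i" using xs by (auto simp: bij_betw_def)
    then show "target \<Gamma> (v, c) \<in> Internal ` S \<union> {Boundary j, Boundary (j + 1)}"
      using edgeS[of i c] by blast
  qed
  then show ?thesis
    using rep_eq[OF iso1] rep_eq[OF iso2] by (intro bexI[of _ S] conjI)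
qed

text \<open>
  If \<open>W\<close> is regarded as the sum of the \<open>W \<Gamma>\<close> times \<open>\<Gamma>\<close> over all representatives, then
  \<open>grafting_coeff W j N \<Gamma>\<close> is the coefficient of a graph \<open>\<Gamma>\<close> with \<open>N\<close> internal vertices in the
  insertion of \<open>W\<close> into itself at the boundary vertex \<open>j\<close>.
\<close>

definition rep_pairs :: "nat \<Rightarrow> (graph \<times> graph) set" where
  "rep_pairs N = (\<Union>a\<le>N. reps (N - a) 2 \<times> reps a 2)"

definition grafting_coeff :: "(graph \<Rightarrow> real) \<Rightarrow> nat \<Rightarrow> nat \<Rightarrow> graph \<Rightarrow> real" where
  "grafting_coeff W j N \<Gamma> = (\<Sum>p\<in>rep_pairs N. W (fst p) * W (snd p) *
     graph_coeff \<Gamma> (insertion j (fst p) (snd p)))"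

lemma finite_rep_pairs: "finite (rep_pairs N)"
  by (auto simp: rep_pairs_def finite_reps)

lemma weight_rep_vanishing:
  assumes W: "weight_system W" and \<Gamma>: "\<Gamma> \<in> graphs n 2" and "vanishing \<Gamma>"
  shows "W (rep \<Gamma>) = 0"
proof -
  have iso: "W \<Gamma>' = s * W \<Gamma>" if "iso s \<Gamma> \<Gamma>'" for s \<Gamma>'
    using W \<Gamma> that unfolding weight_system_def by blast
  have "W \<Gamma> = - 1 * W \<Gamma>" using assms(3) unfolding vanishing_def by (rule iso)
  then have "W \<Gamma> = 0" by simp
  obtain s where "iso s \<Gamma> (rep \<Gamma>)" using rep_iso[of \<Gamma>] by (rule exE)
  from iso[OF this] \<open>W \<Gamma> = 0\<close> show ?thesis by simp
qed

text \<open>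
  The pairs which the coproduct runs over and those which the composition runs over differ only by
  pairs that contribute nothing: either the weight of a factor vanishes or the coefficient does.
\<close>

lemma weight_coproduct:
  assumes W: "weight_system W" and \<Gamma>: "\<Gamma> \<in> graphs N 3"
  shows "weight_tensor W (coproduct \<Gamma>) = (\<Sum>j<2. (-1) ^ j * grafting_coeff W j N \<Gamma>)"
  unfolding weight_tensor_coproduct grafting_coeff_def
proof (rule sum.cong[OF refl], rule arg_cong[of _ _ "(*) _"], rule sum.mono_neutral_cong)
  fix j :: nat assume "j \<in> {..<2}"
  then have j: "j < 2" by simp
  let ?pair = "\<lambda>S. (rep (collapse \<Gamma> j S), rep (subgraph \<Gamma> j S))"
  show "finite (rep_pairs N)" by (rule finite_rep_pairs)
  show "finite (?pair ` subgraphs \<Gamma> j)" by (intro finite_imageI finite_subgraphs)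
  have len: "length \<Gamma> = N" using \<Gamma> by (rule graphs_length)
  show "W (fst p) * W (snd p) * graph_coeff \<Gamma> (insertion j (fst p) (snd p)) = 0"
    if p: "p \<in> rep_pairs N - ?pair ` subgraphs \<Gamma> j" for p
  proof -
    obtain a \<Gamma>1 \<Gamma>2 where p': "p = (\<Gamma>1, \<Gamma>2)" "\<Gamma>1 \<in> reps (N - a) 2" "\<Gamma>2 \<in> reps a 2"
      using p by (auto simp: rep_pairs_def)
    have "class_coeff \<Gamma> (graft j \<Gamma>1 \<Gamma>2 \<rho>) = 0"
      if \<rho>: "\<rho> \<in> set (in_edges \<Gamma>1 (Boundary j)) \<rightarrow>\<^sub>E vertices (length \<Gamma>2) 2" for \<rho>
    proof (rule ccontr)
      assume "class_coeff \<Gamma> (graft j \<Gamma>1 \<Gamma>2 \<rho>) \<noteq> 0"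
      then obtain s where s: "iso s \<Gamma> (graft j \<Gamma>1 \<Gamma>2 \<rho>)" using class_coeff_nonzero by blast
      have "\<rho> \<in> set (in_edges \<Gamma>1 (Boundary j)) \<rightarrow> vertices a 2"
        using \<rho> graphs_length[OF reps_graphs[OF p'(3)]] by auto
      from subgraph_of_graft[OF reps_graphs[OF p'(2)] reps_graphs[OF p'(3)] j this s]
      obtain S where "S \<in> subgraphs \<Gamma> j" "?pair S = p"
        using p' rep_reps[OF p'(2)] rep_reps[OF p'(3)] by auto
      then show False using p by blast
    qed
    then show ?thesis by (simp add: p'(1) graph_coeff_insertion)
  qed
  show "W (fst p) * W (snd p) * graph_coeff \<Gamma> (insertion j (fst p) (snd p)) = 0"
    if p: "p \<in> ?pair ` subgraphs \<Gamma> j - rep_pairs N" for p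
  proof -
    obtain S where S: "S \<in> subgraphs \<Gamma> j" "p = ?pair S" using p by blast
    have sub: "subgraph \<Gamma> j S \<in> graphs (card S) 2" and col: "collapse \<Gamma> j S \<in> graphs (N - card S) 2"
      and "S \<subseteq> {..<N}"
      using S(1) unfolding subgraphs_def len by blast+
    have "card S \<le> N" using card_mono[OF _ \<open>S \<subseteq> _\<close>] by simp
    have "vanishing (subgraph \<Gamma> j S) \<or> vanishing (collapse \<Gamma> j S)"
    proof (rule ccontr)
      assume "\<not> (vanishing (subgraph \<Gamma> j S) \<or> vanishing (collapse \<Gamma> j S))"
      then have "p \<in> reps (N - card S) 2 \<times> reps (card S) 2"
        using rep_in_reps[OF sub] rep_in_reps[OF col] S(2) by simp
      then show False using p \<open>card S \<le> N\<close> by (auto simp: rep_pairs_def)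
    qed
    then show ?thesis
      using weight_rep_vanishing[OF W sub] weight_rep_vanishing[OF W col] S(2) by auto
  qed
qed (rule refl)

lemma weight_coproduct_iso:
  assumes W: "weight_system W" and \<Gamma>: "\<Gamma> \<in> graphs N 3" and iso: "iso s \<Gamma> \<Gamma>'"
  shows "weight_tensor W (coproduct \<Gamma>') = s * weight_tensor W (coproduct \<Gamma>)"
  unfolding weight_coproduct[OF W \<Gamma>] weight_coproduct[OF W iso_graphs[OF iso \<Gamma>]]
    grafting_coeff_def graph_coeff_insertion class_coeff_iso_left[OF iso]
  by (simp add: sum_distrib_left mult_ac)

section \<open>Separating graphs by their operators\<close>

definition edge_code :: "nat \<times> bool \<Rightarrow> nat" where
  "edge_code = (\<lambda>(v, c). 2 * v + (if c then 1 else 0))"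

definition in_codes :: "graph \<Rightarrow> vertex \<Rightarrow> nat set" where
  "in_codes \<Gamma> k = edge_code ` set (in_edges \<Gamma> k)"

text \<open>
  The test tensor of a graph: the coordinates are its edges, and each vertex \<open>v\<close> with outgoing edges
  \<open>e\<close>, \<open>e'\<close> contributes \<open>\<partial>\<^sub>e \<and> \<partial>\<^sub>e\<^sub>'\<close> times the product of the coordinates of the edges into \<open>v\<close>. At the
  origin such a product survives only if it is differentiated exactly once in each of its factors.
\<close>

definition test_tensor :: "graph \<Rightarrow> nat \<Rightarrow> nat \<Rightarrow> (nat \<Rightarrow> real) \<Rightarrow> real" where
  "test_tensor \<Gamma> i j = (\<lambda>x. (if i div 2 = j div 2 \<and> i \<noteq> j then if even i then 1 else -1 else 0) *
     (\<Prod>e\<in>in_codes \<Gamma> (Internal (i div 2)). x e))"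

definition test_function :: "graph \<Rightarrow> nat \<Rightarrow> (nat \<Rightarrow> real) \<Rightarrow> real" where
  "test_function \<Gamma> k = (\<lambda>x. 1 * (\<Prod>e\<in>in_codes \<Gamma> (Boundary k). x e))"

lemma edge_code_eq_iff [simp]: "edge_code e = edge_code e' \<longleftrightarrow> e = e'"
proof
  obtain v c v' c' where e: "e = (v, c)" "e' = (v', c')" by (cases e; cases e')
  assume *: "edge_code e = edge_code e'"
  have code: "edge_code (u, b) div 2 = u" "odd (edge_code (u, b)) = b" for u b
    by (simp_all add: edge_code_def)
  show "e = e'"
    using arg_cong[OF *, of "\<lambda>i. i div 2"] arg_cong[OF *, of odd] unfolding e code by simp
qed simp

lemma finite_in_codes: "finite (in_codes \<Gamma> k)"
  by (simp add: in_codes_def)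

lemma in_codes_subset: "in_codes \<Gamma> k \<subseteq> {..<2 * length \<Gamma>}"
  by (auto simp: in_codes_def set_in_edges edge_code_def)

lemma bivector_test_tensor: "bivector_field (2 * length \<Gamma>) (test_tensor \<Gamma>)"
  unfolding bivector_field_def
proof (intro allI impI conjI ballI)
  fix i j
  show "test_tensor \<Gamma> i j \<in> smooth_functions (2 * length \<Gamma>)"
    unfolding test_tensor_def by (rule monomial_smooth[OF in_codes_subset])
  fix x
  have "even i \<noteq> even j" if "i div 2 = j div 2" "i \<noteq> j"
    using that by presburger
  then show "test_tensor \<Gamma> i j x = - test_tensor \<Gamma> j i x"
    unfolding test_tensor_def by (cases "i div 2 = j div 2"; cases "i = j") simp_all
qed

lemma test_function_smooth: "test_function \<Gamma> k \<in> smooth_functions (2 * length \<Gamma>)"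
  unfolding test_function_def by (rule monomial_smooth[OF in_codes_subset])

lemma test_factor_Internal:
  "pds (map I es) (decoration (test_tensor \<Gamma>) F I (Internal v)) (\<lambda>_. 0) =
    (if I (v, False) div 2 = I (v, True) div 2 \<and> I (v, False) \<noteq> I (v, True) \<and>
      distinct (map I es) \<and> I ` set es = in_codes \<Gamma> (Internal (I (v, False) div 2))
     then if even (I (v, False)) then 1 else -1 else 0)"
  using pds_monomial_0[OF finite_in_codes, of "map I es"]
  by (simp add: decoration_def test_tensor_def)

lemma test_factor_Boundary:
  "pds (map I es) (decoration \<alpha> (test_function \<Gamma>) I (Boundary j)) (\<lambda>_. 0) =
    (if distinct (map I es) \<and> I ` set es = in_codes \<Gamma> (Boundary j) then 1 else 0)"
  using pds_monomial_0[OF finite_in_codes, of "map I es" 1]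
  by (simp add: decoration_def test_function_def)

text \<open>
  The labels of a nonzero summand map the edges of \<open>\<Gamma>\<close> to those of \<open>\<Gamma>0\<close>, bijectively on the edges into
  each vertex, and the two edges leaving a vertex of \<open>\<Gamma>\<close> to the two leaving its image. Such a covering
  is injective: by induction on the height, two vertices with the same image have outgoing edges with
  the same image and the same end, so that these edges and hence the vertices coincide. Thus it is an
  isomorphism, and the value of the summand is its sign.
\<close>

lemma test_summand_iso:
  fixes \<Gamma> \<Gamma>0 :: graph and n m :: nat
  defines "P \<equiv> \<lambda>I. \<Prod>k\<in>vertices n m.
    pds (map I (in_edges \<Gamma> k)) (decoration (test_tensor \<Gamma>0) (test_function \<Gamma>0) I k) (\<lambda>_. 0)"
  assumes \<Gamma>: "\<Gamma> \<in> graphs n m" and len0: "length \<Gamma>0 = n"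
    and I: "I \<in> set (edges \<Gamma>) \<rightarrow> {..<2 * n}" and nz: "P I \<noteq> 0"
  shows "iso (P I) \<Gamma> \<Gamma>0"
proof -
  from \<Gamma> obtain h :: "nat \<Rightarrow> nat" where len: "length \<Gamma> = n"
    and tv: "\<And>v c. v < n \<Longrightarrow> target \<Gamma> (v, c) \<in> vertices n m"
    and h: "\<And>v c u. v < n \<Longrightarrow> target \<Gamma> (v, c) = Internal u \<Longrightarrow> h u < h v"
    unfolding graphs_iff by blast
  define \<phi> where "\<phi> v = I (v, False) div 2" for v
  define t where "t v = odd (I (v, False))" for v
  have fac: "pds (map I (in_edges \<Gamma> k)) (decoration (test_tensor \<Gamma>0) (test_function \<Gamma>0) I k) (\<lambda>_. 0) \<noteq> 0"
    if "k \<in> vertices n m" for k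
    using nz that by (auto simp: P_def)
  have facI: "I (v, False) div 2 = I (v, True) div 2 \<and> I (v, False) \<noteq> I (v, True) \<and>
      distinct (map I (in_edges \<Gamma> (Internal v))) \<and>
      I ` set (in_edges \<Gamma> (Internal v)) = in_codes \<Gamma>0 (Internal (\<phi> v))" if "v < n" for v
    using fac[of "Internal v"] that unfolding test_factor_Internal \<phi>_def
    by (auto split: if_splits)
  have facB: "distinct (map I (in_edges \<Gamma> (Boundary k))) \<and>
      I ` set (in_edges \<Gamma> (Boundary k)) = in_codes \<Gamma>0 (Boundary k)" if "k < m" for k
    using fac[of "Boundary k"] that unfolding test_factor_Boundary by (auto split: if_splits)
  have cover: "inj_on I (set (in_edges \<Gamma> k))"
      "I ` set (in_edges \<Gamma> k) = in_codes \<Gamma>0 (relabel \<phi> k)" if k: "k \<in> vertices n m" for k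
  proof -
    have "inj_on I (set (in_edges \<Gamma> k)) \<and> I ` set (in_edges \<Gamma> k) = in_codes \<Gamma>0 (relabel \<phi> k)"
      using k facI facB by (cases k) (simp_all add: distinct_map)
    then show "inj_on I (set (in_edges \<Gamma> k))"
      "I ` set (in_edges \<Gamma> k) = in_codes \<Gamma>0 (relabel \<phi> k)" by blast+
  qed
  have code: "I (v, c) = edge_code (\<phi> v, c \<noteq> t v)" if v: "v < n" for v c
  proof -
    have "I (v, False) div 2 = I (v, True) div 2" "I (v, False) \<noteq> I (v, True)"
      using facI[OF v] by blast+
    then show ?thesis
      by (cases c; cases "t v") (auto simp: edge_code_def \<phi>_def t_def, presburger+)
  qed
  have \<phi>n: "\<phi> v < n" if "v < n" for v
  proof -
    have "I (v, False) < 2 * n" using I that by (auto simp: Pi_iff set_edges len)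
    then show ?thesis by (simp add: \<phi>_def)
  qed
  have tgt: "target \<Gamma>0 (\<phi> v, c \<noteq> t v) = relabel \<phi> (target \<Gamma> (v, c))" if v: "v < n" for v c
  proof -
    have "(v, c) \<in> set (in_edges \<Gamma> (target \<Gamma> (v, c)))" using v by (simp add: set_in_edges len)
    then have "I (v, c) \<in> in_codes \<Gamma>0 (relabel \<phi> (target \<Gamma> (v, c)))"
      using cover(2)[OF tv[OF v]] by blast
    then have "(\<phi> v, c \<noteq> t v) \<in> set (in_edges \<Gamma>0 (relabel \<phi> (target \<Gamma> (v, c))))"
      unfolding code[OF v] in_codes_def by (auto simp: image_iff)
    then show ?thesis by (simp add: set_in_edges)
  qed
  have inj: "v = v'" if "v < n" "v' < n" "\<phi> v = \<phi> v'" for v v'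
    using that
  proof (induction "h v" arbitrary: v v' rule: less_induct)
    case less
    \<comment> \<open>The edge leaving \<open>v'\<close> with the same image as the first edge leaving \<open>v\<close>\<close>
    define c where "c = (t v \<noteq> t v')"
    have tt: "(False \<noteq> t v) = (c \<noteq> t v')" by (auto simp: c_def)
    have "I (v, False) = I (v', c)"
      unfolding code[OF less.prems(1)] code[OF less.prems(2)] tt less.prems(3) by (rule refl)
    moreover have "target \<Gamma> (v, False) = target \<Gamma> (v', c)"
    proof -
      have eq: "relabel \<phi> (target \<Gamma> (v, False)) = relabel \<phi> (target \<Gamma> (v', c))"
        unfolding tgt[OF less.prems(1), symmetric] tgt[OF less.prems(2), symmetric] tt less.prems(3)
        by (rule refl)
      show ?thesis
      proof (cases "target \<Gamma> (v, False)")
        case (Internal w)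
        then obtain w' where w': "target \<Gamma> (v', c) = Internal w'" "\<phi> w = \<phi> w'"
          using eq by (cases "target \<Gamma> (v', c)") auto
        have "w < n" "w' < n"
          using tv[OF less.prems(1), of False] tv[OF less.prems(2), of c] Internal w'(1) by simp_all
        then have "w = w'"
          using less.hyps[OF h[OF less.prems(1) Internal]] w'(2) by blast
        then show ?thesis using Internal w' by simp
      next
        case (Boundary k)
        then show ?thesis using eq by (cases "target \<Gamma> (v', c)") auto
      qed
    qed
    moreover have "(v, False) \<in> set (in_edges \<Gamma> (target \<Gamma> (v, False)))"
      "(v', c) \<in> set (in_edges \<Gamma> (target \<Gamma> (v', c)))"
      using less.prems by (simp_all add: set_in_edges len)
    ultimately have "(v, False) = (v', c)"
      using cover(1)[OF tv[OF less.prems(1)], of False] by (metis inj_onD)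
    then show ?case by simp
  qed
  have bij: "bij_betw \<phi> {..<n} {..<n}"
    unfolding bij_betw_def
  proof
    show inj_on: "inj_on \<phi> {..<n}" using inj by (auto intro!: inj_onI)
    show "\<phi> ` {..<n} = {..<n}"
      using \<phi>n by (intro endo_inj_surj inj_on) auto
  qed
  have "iso (\<Prod>v<n. if t v then -1 else 1) \<Gamma> \<Gamma>0"
  proof (rule iso_of_bij[OF len len0 bij tgt])
    show "u < n" if "v < n" "target \<Gamma> (v, c) = Internal u" for v c u
      using tv[OF that(1), of c] unfolding that(2) by simp
  qed
  also have "(\<Prod>v<n. if t v then -1 else 1) = P I"
  proof -
    have "(\<Prod>v<n. pds (map I (in_edges \<Gamma> (Internal v)))
        (decoration (test_tensor \<Gamma>0) (test_function \<Gamma>0) I (Internal v)) (\<lambda>_. 0)) =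
        (\<Prod>v<n. if t v then -1 else 1)"
      unfolding test_factor_Internal using facI by (intro prod.cong) (auto simp: t_def \<phi>_def)
    moreover have "(\<Prod>j<m. pds (map I (in_edges \<Gamma> (Boundary j)))
        (decoration (test_tensor \<Gamma>0) (test_function \<Gamma>0) I (Boundary j)) (\<lambda>_. 0)) = 1"
      unfolding test_factor_Boundary using facB by (intro prod.neutral) auto
    ultimately show ?thesis by (simp add: P_def prod_vertices)
  qed
  finally show ?thesis .
qed

lemma graph_operator_test_not_iso:
  assumes \<Gamma>: "\<Gamma> \<in> graphs n m" and \<Gamma>0: "\<Gamma>0 \<in> graphs n m" and "\<nexists>s. iso s \<Gamma> \<Gamma>0"
  shows "graph_operator (2 * n) (test_tensor \<Gamma>0) m (test_function \<Gamma>0) \<Gamma> (\<lambda>_. 0) = 0"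
  unfolding graph_operator_def graphs_length[OF \<Gamma>]
proof (rule sum.neutral, rule ballI, rule ccontr)
  fix I assume I: "I \<in> set (edges \<Gamma>) \<rightarrow>\<^sub>E {..<2 * n}" and nz: "(\<Prod>k\<in>vertices n m.
    pds (map I (in_edges \<Gamma> k)) (decoration (test_tensor \<Gamma>0) (test_function \<Gamma>0) I k) (\<lambda>_. 0)) \<noteq> 0"
  have "I \<in> set (edges \<Gamma>) \<rightarrow> {..<2 * n}" using I by auto
  from test_summand_iso[OF \<Gamma> graphs_length[OF \<Gamma>0] this nz] assms(3) show False by blast
qed

text \<open>
  On the test data of \<open>\<Gamma>\<close> itself, the summands are the signs of automorphisms. They are all positive
  because \<open>\<Gamma>\<close> does not vanish, and the identity does contribute.
\<close>

lemma graph_operator_test_pos: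
  assumes \<Gamma>: "\<Gamma> \<in> graphs n m" and nv: "\<not> vanishing \<Gamma>"
  shows "graph_operator (2 * n) (test_tensor \<Gamma>) m (test_function \<Gamma>) \<Gamma> (\<lambda>_. 0) > 0"
proof -
  let ?D = "set (edges \<Gamma>) \<rightarrow>\<^sub>E {..<2 * n}"
  let ?P = "\<lambda>I. \<Prod>k\<in>vertices n m.
    pds (map I (in_edges \<Gamma> k)) (decoration (test_tensor \<Gamma>) (test_function \<Gamma>) I k) (\<lambda>_. 0)"
  have len: "length \<Gamma> = n" by (rule graphs_length[OF \<Gamma>])
  have nonneg: "?P I \<ge> 0" if I: "I \<in> ?D" for I
  proof (cases "?P I = 0")
    case False
    have "I \<in> set (edges \<Gamma>) \<rightarrow> {..<2 * n}" using I by auto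
    from test_summand_iso[OF \<Gamma> len this False] have iso: "iso (?P I) \<Gamma> \<Gamma>" .
    moreover have "?P I \<noteq> -1" using iso nv unfolding vanishing_def by metis
    ultimately show ?thesis using iso_sign[OF iso] by linarith
  qed (simp only: order_refl)
  define J where "J = restrict edge_code (set (edges \<Gamma>))"
  have J: "J \<in> ?D" by (auto simp: J_def set_edges len edge_code_def)
  have im: "map J (in_edges \<Gamma> k) = map edge_code (in_edges \<Gamma> k)" for k
    by (simp add: J_def in_edges_def)
  have dist: "distinct (map J (in_edges \<Gamma> k))" for k
    unfolding im by (simp add: distinct_map distinct_in_edges inj_on_def)
  have img: "J ` set (in_edges \<Gamma> k) = in_codes \<Gamma> k" for k
    using im[of k] by (metis in_codes_def list.set_map)
  have "?P J = 1"
  proof (rule prod.neutral, rule ballI)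
    fix k assume k: "k \<in> vertices n m"
    show "pds (map J (in_edges \<Gamma> k)) (decoration (test_tensor \<Gamma>) (test_function \<Gamma>) J k) (\<lambda>_. 0) = 1"
    proof (cases k)
      case (Internal v)
      then have "v < n" using k by simp
      then have "J (v, False) = 2 * v" "J (v, True) = 2 * v + 1"
        by (simp_all add: J_def set_edges len edge_code_def)
      then show ?thesis
        using dist[of k] img[of k] unfolding Internal test_factor_Internal by simp
    next
      case (Boundary j)
      then show ?thesis
        using dist[of k] img[of k] unfolding Boundary test_factor_Boundary by simp
    qed
  qed
  moreover have "finite ?D" by (intro finite_PiE) auto
  ultimately show ?thesis
    unfolding graph_operator_def len using J nonneg by (intro sum_pos2[of ?D J]) auto
qed

section \<open>The associator\<close>

lemma pds_zero: "pds is (\<lambda>_. 0) = (\<lambda>_. 0)"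
proof (induction "is")
  case (Cons i "is")
  have "pd i (\<lambda>_. 0) = (\<lambda>_. 0)" by (simp add: pd_def fun_eq_iff)
  then show ?case by (simp add: Cons.IH)
qed simp

lemma U_zero:
  assumes "j < length fs" "fs ! j = 0"
  shows "U d \<alpha> \<Gamma> fs x = 0"
proof -
  have "(\<Prod>j<length fs. pds (map I (in_edges \<Gamma> (Boundary j))) (fs ! j) x) = 0" for I
  proof (rule prod_zero)
    show "\<exists>j\<in>{..<length fs}. pds (map I (in_edges \<Gamma> (Boundary j))) (fs ! j) x = 0"
      using assms by (intro bexI[of _ j]) (simp_all add: zero_fun_def pds_zero)
  qed simp
  then show ?thesis unfolding U_def by (simp only: mult_zero_right sum.neutral_const)
qed

lemma star_coeff_zero:
  "star_coeff W d \<alpha> n 0 g x = 0" "star_coeff W d \<alpha> n f 0 x = 0"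
  using U_zero[of 0 "[0, g]"] U_zero[of 1 "[f, 0]"] by (simp_all add: star_coeff_def)

lemma star_nth_const:
  "fps_nth (star W d \<alpha> F (fps_const h)) N x = (\<Sum>a\<le>N. star_coeff W d \<alpha> (N - a) (fps_nth F a) h x)"
  "fps_nth (star W d \<alpha> (fps_const f) G) N x = (\<Sum>a\<le>N. star_coeff W d \<alpha> (N - a) f (fps_nth G a) x)"
proof -
  let ?T = "{(n, a, b). n + a + b = (N::nat)}"
  have fin: "finite ?T"
    by (rule finite_subset[of _ "{..N} \<times> {..N} \<times> {..N}"]) auto
  have "fps_nth (star W d \<alpha> F (fps_const h)) N x =
      (\<Sum>(n, a, b)\<in>(\<lambda>a. (N - a, a, 0)) ` {..N}. star_coeff W d \<alpha> n (fps_nth F a) (fps_nth (fps_const h) b) x)"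
    unfolding star_def fps_nth_Abs_fps
    by (intro sum.mono_neutral_right fin) (auto simp: star_coeff_zero image_iff split: if_splits)
  then show "fps_nth (star W d \<alpha> F (fps_const h)) N x = (\<Sum>a\<le>N. star_coeff W d \<alpha> (N - a) (fps_nth F a) h x)"
    by (simp add: sum.reindex inj_on_def)
  have "fps_nth (star W d \<alpha> (fps_const f) G) N x =
      (\<Sum>(n, a, b)\<in>(\<lambda>b. (N - b, 0, b)) ` {..N}. star_coeff W d \<alpha> n (fps_nth (fps_const f) a) (fps_nth G b) x)"
    unfolding star_def fps_nth_Abs_fps
    by (intro sum.mono_neutral_right fin) (auto simp: star_coeff_zero image_iff split: if_splits)
  then show "fps_nth (star W d \<alpha> (fps_const f) G) N x = (\<Sum>a\<le>N. star_coeff W d \<alpha> (N - a) f (fps_nth G a) x)"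
    by (simp add: sum.reindex inj_on_def)
qed

lemma star_const_const:
  "fps_nth (star W d \<alpha> (fps_const f) (fps_const g)) n = star_coeff W d \<alpha> n f g"
proof
  fix x
  have "fps_nth (star W d \<alpha> (fps_const f) (fps_const g)) n x =
      (\<Sum>a\<in>{0}. star_coeff W d \<alpha> (n - a) (fps_nth (fps_const f) a) g x)"
    unfolding star_nth_const(1)
    by (intro sum.mono_neutral_right) (auto simp: star_coeff_zero)
  then show "fps_nth (star W d \<alpha> (fps_const f) (fps_const g)) n x = star_coeff W d \<alpha> n f g x"
    by simp
qed

text \<open>
  One half of the associator in order \<open>N\<close>: each grafted graph is replaced by its representative, and
  exchanging the sums collects the coefficient of each representative.
\<close>

lemma sum_graft_operators:
  assumes \<alpha>: "bivector_field d \<alpha>" and F: "\<And>k. k < 3 \<Longrightarrow> F k \<in> smooth_functions d"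
    and x: "x \<in> topspace (Euclidean_space d)" and "j < 2"
  shows "(\<Sum>a\<le>N. \<Sum>\<Gamma>1\<in>reps (N - a) 2. W \<Gamma>1 * (\<Sum>\<Gamma>2\<in>reps a 2. W \<Gamma>2 *
      (\<Sum>\<rho>\<in>set (in_edges \<Gamma>1 (Boundary j)) \<rightarrow>\<^sub>E vertices a 2.
        graph_operator d \<alpha> 3 F (graft j \<Gamma>1 \<Gamma>2 \<rho>) x))) =
    (\<Sum>\<Gamma>\<in>reps N 3. grafting_coeff W j N \<Gamma> * graph_operator d \<alpha> 3 F \<Gamma> x)"
proof -
  let ?V = "\<lambda>\<Gamma>. graph_operator d \<alpha> 3 F \<Gamma> x"
  let ?P = "\<lambda>\<Gamma>1 \<Gamma>2. set (in_edges \<Gamma>1 (Boundary j)) \<rightarrow>\<^sub>E vertices (length \<Gamma>2) 2"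
  let ?c = "\<lambda>\<Gamma> p. W (fst p) * W (snd p) * graph_coeff \<Gamma> (insertion j (fst p) (snd p))"
  have inner: "W \<Gamma>1 * (W \<Gamma>2 * (\<Sum>\<rho>\<in>set (in_edges \<Gamma>1 (Boundary j)) \<rightarrow>\<^sub>E vertices a 2.
        ?V (graft j \<Gamma>1 \<Gamma>2 \<rho>))) = (\<Sum>\<Gamma>\<in>reps N 3. ?c \<Gamma> (\<Gamma>1, \<Gamma>2) * ?V \<Gamma>)"
    if a: "a \<le> N" and g: "\<Gamma>1 \<in> reps (N - a) 2" "\<Gamma>2 \<in> reps a 2" for a \<Gamma>1 \<Gamma>2
  proof -
    have len2: "length \<Gamma>2 = a" by (rule graphs_length[OF reps_graphs[OF g(2)]])
    have "?V (graft j \<Gamma>1 \<Gamma>2 \<rho>) = (\<Sum>\<Gamma>\<in>reps N 3. class_coeff \<Gamma> (graft j \<Gamma>1 \<Gamma>2 \<rho>) * ?V \<Gamma>)"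
      if \<rho>: "\<rho> \<in> ?P \<Gamma>1 \<Gamma>2" for \<rho>
    proof (rule graph_operator_reps[OF \<alpha> F x])
      have "\<rho> \<in> set (in_edges \<Gamma>1 (Boundary j)) \<rightarrow> vertices a 2" using \<rho> len2 by auto
      from graft_in_graphs[OF reps_graphs[OF g(1)] reps_graphs[OF g(2)] \<open>j < 2\<close> this]
      show "graft j \<Gamma>1 \<Gamma>2 \<rho> \<in> graphs N 3" using a by simp
    qed
    then have "(\<Sum>\<rho>\<in>?P \<Gamma>1 \<Gamma>2. ?V (graft j \<Gamma>1 \<Gamma>2 \<rho>)) =
        (\<Sum>\<rho>\<in>?P \<Gamma>1 \<Gamma>2. \<Sum>\<Gamma>\<in>reps N 3. class_coeff \<Gamma> (graft j \<Gamma>1 \<Gamma>2 \<rho>) * ?V \<Gamma>)"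
      by (rule sum.cong[OF refl])
    also have "\<dots> = (\<Sum>\<Gamma>\<in>reps N 3. graph_coeff \<Gamma> (insertion j \<Gamma>1 \<Gamma>2) * ?V \<Gamma>)"
      unfolding graph_coeff_insertion sum_distrib_right by (rule sum.swap)
    finally show ?thesis by (simp add: len2 sum_distrib_left mult.assoc)
  qed
  have "(\<Sum>a\<le>N. \<Sum>\<Gamma>1\<in>reps (N - a) 2. W \<Gamma>1 * (\<Sum>\<Gamma>2\<in>reps a 2. W \<Gamma>2 *
      (\<Sum>\<rho>\<in>set (in_edges \<Gamma>1 (Boundary j)) \<rightarrow>\<^sub>E vertices a 2. ?V (graft j \<Gamma>1 \<Gamma>2 \<rho>)))) =
    (\<Sum>a\<le>N. \<Sum>\<Gamma>1\<in>reps (N - a) 2. \<Sum>\<Gamma>2\<in>reps a 2. \<Sum>\<Gamma>\<in>reps N 3. ?c \<Gamma> (\<Gamma>1, \<Gamma>2) * ?V \<Gamma>)"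
    unfolding sum_distrib_left[of "W _" _ "reps _ 2"]
    by (rule sum.cong[OF refl], rule sum.cong[OF refl], rule sum.cong[OF refl], rule inner) auto
  also have "\<dots> = (\<Sum>a\<le>N. \<Sum>p\<in>reps (N - a) 2 \<times> reps a 2. \<Sum>\<Gamma>\<in>reps N 3. ?c \<Gamma> p * ?V \<Gamma>)"
    by (simp add: sum.cartesian_product')
  also have "\<dots> = (\<Sum>p\<in>rep_pairs N. \<Sum>\<Gamma>\<in>reps N 3. ?c \<Gamma> p * ?V \<Gamma>)"
    unfolding rep_pairs_def
  proof (rule sum.UNION_disjoint[symmetric])
    \<comment> \<open>The second graph of a pair determines \<open>a\<close>.\<close>
    have "length \<Gamma> = a" if "\<Gamma> \<in> reps a 2" for \<Gamma> a
      by (rule graphs_length[OF reps_graphs[OF that]])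
    then show "\<forall>a\<in>{..N}. \<forall>b\<in>{..N}. a \<noteq> b \<longrightarrow>
        (reps (N - a) 2 \<times> reps a 2) \<inter> (reps (N - b) 2 \<times> reps b 2) = {}"
      by blast
  qed (auto simp: finite_reps)
  also have "\<dots> = (\<Sum>\<Gamma>\<in>reps N 3. grafting_coeff W j N \<Gamma> * ?V \<Gamma>)"
    unfolding grafting_coeff_def sum_distrib_right by (rule sum.swap)
  finally show ?thesis .
qed

lemma star_coeff_eq_graph_operator:
  "star_coeff W d \<alpha> n f g x = (\<Sum>\<Gamma>\<in>reps n 2. W \<Gamma> * graph_operator d \<alpha> 2 ((!) [f, g]) \<Gamma> x)"
  unfolding star_coeff_def U_eq_graph_operator by (simp add: numeral_2_eq_2)

text \<open>
  Grafting at the first boundary vertex produces \<open>(f \<star> g) \<star> h\<close> and at the second \<open>f \<star> (g \<star> h)\<close>, so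
  their difference has the sign \<open>(-1)\<^sup>j\<close> of the coproduct.
\<close>

lemma associator_eq:
  assumes W: "weight_system W" and \<alpha>: "bivector_field d \<alpha>"
    and fgh: "f \<in> smooth_functions d" "g \<in> smooth_functions d" "h \<in> smooth_functions d"
    and x: "x \<in> topspace (Euclidean_space d)"
  shows "fps_nth (gerstenhaber (star W d \<alpha>) (star W d \<alpha>) (fps_const f) (fps_const g) (fps_const h)) N x =
    (\<Sum>\<Gamma>\<in>reps N 3. weight_tensor W (coproduct \<Gamma>) * graph_operator d \<alpha> 3 ((!) [f, g, h]) \<Gamma> x)"
proof -
  let ?F = "(!) [f, g, h]"
  have F: "?F k \<in> smooth_functions d" if "k < 3" for k
    using that fgh by (auto simp: less_Suc_eq numeral_3_eq_3)
  have A: "reps a 2 \<subseteq> graphs a 2" for a using reps_graphs by blast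
  have left: "star_coeff W d \<alpha> (N - a) (star_coeff W d \<alpha> a f g) h x =
      (\<Sum>\<Gamma>1\<in>reps (N - a) 2. W \<Gamma>1 * (\<Sum>\<Gamma>2\<in>reps a 2. W \<Gamma>2 *
        (\<Sum>\<rho>\<in>set (in_edges \<Gamma>1 (Boundary 0)) \<rightarrow>\<^sub>E vertices a 2.
          graph_operator d \<alpha> 3 ?F (graft 0 \<Gamma>1 \<Gamma>2 \<rho>) x)))" for a
    unfolding star_coeff_eq_graph_operator[of W d \<alpha> "N - a"]
  proof (rule sum.cong[OF refl], rule arg_cong[of _ _ "(*) _"],
      rule graph_operator_graft[where F = "?F", OF \<alpha> F x finite_reps A])
    fix \<Gamma>1 assume "\<Gamma>1 \<in> reps (N - a) 2"
    then show "\<Gamma>1 \<in> graphs (N - a) 2" by (rule reps_graphs)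
    show "[star_coeff W d \<alpha> a f g, h] ! k = ?F (if k < 0 then k else k + 1)" if "k \<noteq> 0" for k
      using that by (cases k) auto
    show "([star_coeff W d \<alpha> a f g, h] ! 0) y =
        (\<Sum>\<Gamma>2\<in>reps a 2. W \<Gamma>2 * graph_operator d \<alpha> 2 (\<lambda>k. ?F (0 + k)) \<Gamma>2 y)" for y
      unfolding nth_Cons_0 star_coeff_eq_graph_operator
      by (intro sum.cong refl arg_cong[of _ _ "(*) _"] graph_operator_cong) (auto simp: less_2_cases_iff)
  qed simp_all
  have right: "star_coeff W d \<alpha> (N - a) f (star_coeff W d \<alpha> a g h) x =
      (\<Sum>\<Gamma>1\<in>reps (N - a) 2. W \<Gamma>1 * (\<Sum>\<Gamma>2\<in>reps a 2. W \<Gamma>2 *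
        (\<Sum>\<rho>\<in>set (in_edges \<Gamma>1 (Boundary 1)) \<rightarrow>\<^sub>E vertices a 2.
          graph_operator d \<alpha> 3 ?F (graft 1 \<Gamma>1 \<Gamma>2 \<rho>) x)))" for a
    unfolding star_coeff_eq_graph_operator[of W d \<alpha> "N - a"]
  proof (rule sum.cong[OF refl], rule arg_cong[of _ _ "(*) _"],
      rule graph_operator_graft[where F = "?F", OF \<alpha> F x finite_reps A])
    fix \<Gamma>1 assume "\<Gamma>1 \<in> reps (N - a) 2"
    then show "\<Gamma>1 \<in> graphs (N - a) 2" by (rule reps_graphs)
    show "[f, star_coeff W d \<alpha> a g h] ! k = ?F (if k < 1 then k else k + 1)" if "k \<noteq> 1" for k
      using that by (cases k; cases "k - 1") auto
    show "([f, star_coeff W d \<alpha> a g h] ! 1) y =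
        (\<Sum>\<Gamma>2\<in>reps a 2. W \<Gamma>2 * graph_operator d \<alpha> 2 (\<lambda>k. ?F (1 + k)) \<Gamma>2 y)" for y
      unfolding One_nat_def nth_Cons_Suc nth_Cons_0 star_coeff_eq_graph_operator
      by (intro sum.cong refl arg_cong[of _ _ "(*) _"] graph_operator_cong) auto
  qed simp_all
  have "fps_nth (gerstenhaber (star W d \<alpha>) (star W d \<alpha>) (fps_const f) (fps_const g) (fps_const h)) N x =
      (\<Sum>a\<le>N. star_coeff W d \<alpha> (N - a) (star_coeff W d \<alpha> a f g) h x) -
      (\<Sum>a\<le>N. star_coeff W d \<alpha> (N - a) f (star_coeff W d \<alpha> a g h) x)"
    by (simp add: gerstenhaber_def star_nth_const star_const_const)
  also have "\<dots> = (\<Sum>\<Gamma>\<in>reps N 3. grafting_coeff W 0 N \<Gamma> * graph_operator d \<alpha> 3 ?F \<Gamma> x) -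
      (\<Sum>\<Gamma>\<in>reps N 3. grafting_coeff W 1 N \<Gamma> * graph_operator d \<alpha> 3 ?F \<Gamma> x)"
    unfolding left right
    by (simp only: sum_graft_operators[where F = "?F", OF \<alpha> F x] pos2 one_less_numeral_iff num.simps semiring_norm)
  also have "\<dots> = (\<Sum>\<Gamma>\<in>reps N 3. weight_tensor W (coproduct \<Gamma>) * graph_operator d \<alpha> 3 ?F \<Gamma> x)"
    unfolding sum_subtractf[symmetric]
    by (intro sum.cong refl)
      (simp add: weight_coproduct[OF W reps_graphs] numeral_2_eq_2 algebra_simps)
  finally show ?thesis .
qed

section \<open>Associativity and the coproduct\<close>

lemma weight_coproduct_vanishing:
  assumes W: "weight_system W" and \<Gamma>: "\<Gamma> \<in> graphs N 3" and "vanishing \<Gamma>"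
  shows "weight_tensor W (coproduct \<Gamma>) = 0"
  using weight_coproduct_iso[OF W \<Gamma>, of "-1" \<Gamma>] assms(3) by (simp add: vanishing_def)

theorem proposition4p1:
  fixes W :: "graph \<Rightarrow> real"
  assumes "weight_system W"
  shows "(\<forall>d \<alpha>. bivector_field d \<alpha> \<longrightarrow> star_associative W d \<alpha>) \<longleftrightarrow>
    (\<forall>n. \<forall>\<Gamma>\<in>graphs n 3. weight_tensor W (coproduct \<Gamma>) = 0)"
proof
  assume assoc: "\<forall>d \<alpha>. bivector_field d \<alpha> \<longrightarrow> star_associative W d \<alpha>"
  have reps: "weight_tensor W (coproduct \<Gamma>) = 0" if \<Gamma>: "\<Gamma> \<in> reps N 3" for N \<Gamma>
  proof -
    let ?\<alpha> = "test_tensor \<Gamma>" and ?f = "test_function \<Gamma>" and ?d = "2 * N"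
    let ?V = "\<lambda>G. graph_operator ?d ?\<alpha> 3 ((!) [?f 0, ?f 1, ?f 2]) G (\<lambda>_. 0)"
    have len: "length \<Gamma> = N" by (rule graphs_length[OF reps_graphs[OF \<Gamma>]])
    have \<alpha>: "bivector_field ?d ?\<alpha>" and f: "?f k \<in> smooth_functions ?d" for k
      using bivector_test_tensor[of \<Gamma>] test_function_smooth[of \<Gamma>] by (simp_all add: len)
    have x: "(\<lambda>_. 0) \<in> topspace (Euclidean_space ?d)" by (simp add: topspace_Euclidean_space)
    have V: "?V G = graph_operator ?d ?\<alpha> 3 ?f G (\<lambda>_. 0)" for G
      by (rule graph_operator_cong) (auto simp: less_Suc_eq numeral_3_eq_3 numeral_2_eq_2)
    have "?V G = 0" if "G \<in> reps N 3 - {\<Gamma>}" for G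
    proof -
      have "\<nexists>s. iso s G \<Gamma>"
        using rep_eq rep_reps[OF \<Gamma>] rep_reps[of G N 3] that by (metis DiffE singletonI)
      then show ?thesis
        unfolding V using that by (intro graph_operator_test_not_iso reps_graphs[OF \<Gamma>])
          (auto intro: reps_graphs)
    qed
    then have "(\<Sum>G\<in>reps N 3. weight_tensor W (coproduct G) * ?V G) =
        weight_tensor W (coproduct \<Gamma>) * ?V \<Gamma>"
      by (subst sum.remove[OF finite_reps \<Gamma>]) simp
    moreover have "(\<Sum>G\<in>reps N 3. weight_tensor W (coproduct G) * ?V G) = 0"
      using assoc \<alpha> f x unfolding star_associative_def associator_eq[OF assms \<alpha> f f f x, symmetric]
      by blast
    moreover have "?V \<Gamma> > 0"
      unfolding V by (rule graph_operator_test_pos[OF reps_graphs[OF \<Gamma>] reps_not_vanishing[OF \<Gamma>]])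
    ultimately show ?thesis by simp
  qed
  show "\<forall>n. \<forall>\<Gamma>\<in>graphs n 3. weight_tensor W (coproduct \<Gamma>) = 0"
  proof (intro allI ballI)
    fix n \<Gamma> assume \<Gamma>: "\<Gamma> \<in> graphs n 3"
    show "weight_tensor W (coproduct \<Gamma>) = 0"
    proof (cases "vanishing \<Gamma>")
      case True
      then show ?thesis by (rule weight_coproduct_vanishing[OF assms \<Gamma>])
    next
      case False
      obtain s where s: "iso s \<Gamma> (rep \<Gamma>)" using rep_iso[of \<Gamma>] by (rule exE)
      show ?thesis
        using weight_coproduct_iso[OF assms \<Gamma> s] reps[OF rep_in_reps[OF \<Gamma> False]] iso_sign[OF s]
        by auto
    qed
  qed
next
  assume "\<forall>n. \<forall>\<Gamma>\<in>graphs n 3. weight_tensor W (coproduct \<Gamma>) = 0"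
  then have zero: "weight_tensor W (coproduct \<Gamma>) = 0" if "\<Gamma> \<in> reps n 3" for n \<Gamma>
    using that reps_graphs by blast
  show "\<forall>d \<alpha>. bivector_field d \<alpha> \<longrightarrow> star_associative W d \<alpha>"
    unfolding star_associative_def by (simp add: associator_eq[OF assms] zero)
qed

end
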